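(* Put $r_{\mathbf{n}}=r_1r_2$, $n_{\mathbf{n}}=n_1n_2$, $v_{\mathbf{n}}=\mathbb{P}(X_{\mathbf{n},\mathbf{1}}\in A)$, and let $Y_{\mathbf{n}}$ denote a generic block, distributed as $Y_{\mathbf{n},11}$. Suppose that: (1) $r_i=o(n_i)$ for $i=1,2$, $r_{\mathbf{n}}v_{\mathbf{n}}\to\tau<\infty$ and $n_{\mathbf{n}}v_{\mathbf{n}}\to\infty$ as $\mathbf{n}\to\infty$; (2) for all $\epsilon>0$ and all $f\in\mathcal{F}$, $$(r_{\mathbf{n}}v_{\mathbf{n}})^{-1}\,\mathbb{E}\Big[(f(Y_{\mathbf{n}})-\mathbb{E}f(Y_{\mathbf{n}}))^2\,\mathbb{I}_{\{|f(Y_{\mathbf{n}})-\mathbb{E}f(Y_{\mathbf{n}})|>\epsilon\sqrt{n_{\mathbf{n}}v_{\mathbf{n}}}\}}\Big]\to0\quad\text{as }\mathbf{n}\to\infty;$$ (3) for all $f,g\in\mathcal{F}$, $(r_{\mathbf{n}}v_{\mathbf{n}})^{-1}\operatorname{Cov}(f(Y_{\mathbf{n}}),g(Y_{\mathbf{n}}))\to c(f,g)$ as $\mathbf{n}\to\infty$; (4) for each $k\in\mathbb{N}$, all $\mathbf{t}\in\mathbb{R}^k$ and all $k$-tuples $\mathbf{f}_k=(f_1,\dots,f_k)\in\mathcal{F}^k$, $T_{\mathbf{n},\mathbf{t}}(\mathbf{f}_k)\to0$ as $\mathbf{n}\to\infty$, where $$T_{\mathbf{n},\mathbf{t}}(\mathbf{f}_k):=\sum_{(j_1,j_2)\in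 D_{\mathbf{n},2}}\left|\operatorname{Cov}\left(\exp\Big(\mathrm{i}\Big\langle\mathbf{t},\sum_{(u_1,u_2)\in D_{\mathbf{n},2}:\ u_1>j_1\text{ or }(u_1=j_1,\ u_2>j_2)}W_{\mathbf{n},u_1u_2}\Big\rangle\Big),\ \exp\big(\mathrm{i}\langle\mathbf{t},W_{\mathbf{n},j_1j_2}\rangle\big)\right)\right|.$$ Then the finite-dimensional marginal distributions of the empirical process $(Z_{\mathbf{n}}(f))_{f\in\mathcal{F}}$, $$Z_{\mathbf{n}}(f):=\frac{1}{\sqrt{n_{\mathbf{n}}v_{\mathbf{n}}}}\sum_{(j_1,j_2)\in D_{\mathbf{n},2}}\big(f(Y_{\mathbf{n},j_1j_2})-\mathbb{E}f(Y_{\mathbf{n},j_1j_2})\big),$$ converge, as $\mathbf{n}\to\infty$, to the finite-dimensional marginal distributions of a (centered) Gaussian process $(Z(f))_{f\in\mathcal{F}}$ with covariance function $c$.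
   Context: Notation: $[j]=\{1,\dots,j\}$, $[i:j]=\{i,i+1,\dots,j\}$, $\mathbf{n}=(n_1,n_2)\in\mathbb{N}^2$, $\mathbf{1}=(1,1)$; $\mathbf{n}\to\infty$ means $n_1\to\infty$ and $n_2\to\infty$; $\mathrm{i}$ in exponents is the imaginary unit; $\langle\cdot,\cdot\rangle$ is the Euclidean inner product. For complex random variables, $\operatorname{Cov}(U,V)=\mathbb{E}[UV]-\mathbb{E}[U]\mathbb{E}[V]$. Empty sums are $0$. Random field and blocks. $X=\{X_{\mathbf{t}}:\mathbf{t}\in\mathbb{N}^2\}$ is a stationary $\mathbb{R}^q$-valued random field. $E\subseteq\mathbb{R}^q$ is a measurable set with $0\in E$, and $A\subseteq E\setminus\{0\}$ is a measurable set (the relevance set). For $\mathbf{n}\in\mathbb{N}^2$ and $\mathbf{t}\in[n_1]\times[n_2]$, the normalized observations are $X_{\mathbf{n},\mathbf{t}}=L_{\mathbf{n}}(X_{\mathbf{t}})\mathbb{I}_A(X_{\mathbf{t}})$ ($E$-valued), where $L_{\mathbf{n}}:\mathbb{R}^q\to\mathbb{R}^q$ are measurable functions such that $\mathbb{P}(X_{\mathbf{n},\mathbf{1}}\in\cdot\mid X_{\mathbf{n},\mathbf{1}}\in A)\to G(\cdot)$ as $\mathbf{n}\to\infty$ for a non-degenerate distribution $G$. For $i=1,2$, $r_i=r_{n_i}$ is a positive integer, $m_i=\lfloor n_i/r_i\rfloor$, and $D_{\mathbf{n},2}=[m_1]\times[m_2]$. The blocks are $$Y_{\mathbf{n},ij}=(X_{\mathbf{n},\mathbf{t}})_{\mathbf{t}\in[(i-1)r_1+1:\,ir_1]\times[(j-1)r_2+1:\,jr_2]},\quad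 (i,j)\in D_{\mathbf{n},2}.$$ Cluster functionals. Let $E_\cup$ be the set of all $E$-valued arrays of sizes $l_1\times l_2$, $l_1,l_2\in\mathbb{N}$, with the $\sigma$-field $\mathcal{E}_\cup$ induced by the Borel $\sigma$-fields. The core $\mathcal{C}(y)$ of an array $y=(x_{\mathbf{t}})$ is the smallest rectangular sub-array of $y$ containing all entries $x_{\mathbf{t}}\in A$, if there is at least one such entry, and $\mathcal{C}(y)=0$ otherwise. A cluster functional is a measurable map $f:(E_\cup,\mathcal{E}_\cup)\to(\mathbb{R},\mathcal{B}(\mathbb{R}))$ with $f(y)=f(\mathcal{C}(y))$ for all $y\in E_\cup$ and $f(0)=0$. $\mathcal{F}$ is a class of cluster functionals. Block vectors. For $\mathbf{f}_k=(f_1,\dots,f_k)\in\mathcal{F}^k$ and $(i,j)\in D_{\mathbf{n},2}$, $$W_{\mathbf{n},ij}=\frac{1}{\sqrt{n_{\mathbf{n}}v_{\mathbf{n}}}}\big(f_1(Y_{\mathbf{n},ij})-\mathbb{E}f_1(Y_{\mathbf{n},ij}),\dots,f_k(Y_{\mathbf{n},ij})-\mathbb{E}f_k(Y_{\mathbf{n},ij})\big).$$ *)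

theory Defs
  imports "HOL-Probability.Probability"
begin

abbreviation pos_idx :: "(nat \<times> nat) set" where
  "pos_idx \<equiv> {1..} \<times> {1..}"

abbreviation both_inf :: "(nat \<times> nat) filter" where
  "both_inf \<equiv> sequentially \<times>\<^sub>F sequentially"

definition grid :: "nat \<times> nat \<Rightarrow> (nat \<times> nat) set" where
  "grid l = {1..fst l} \<times> {1..snd l}"

(* Cov(U,V) = E[UV] - E[U] E[V]; in the complex case without conjugation. *)
definition cov :: "'w measure \<Rightarrow> ('w \<Rightarrow> 'b) \<Rightarrow> ('w \<Rightarrow> 'b) \<Rightarrow>
    'b::{real_normed_field, banach, second_countable_topology}" where
  "cov M U V = (\<integral>\<omega>. U \<omega> * V \<omega> \<partial>M) - (\<integral>\<omega>. U \<omega> \<partial>M) * (\<integral>\<omega>. V \<omega> \<partial>M)"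

(* Weak convergence along an arbitrary filter, tested on bounded continuous functions on the
   space of the limit measure. For measures on PiM {1..k} (\<lambda>_. borel), that space is the
   set of functions that are undefined off {1..k}; with the subspace topology inherited from the
   product topology on functions it is homeomorphic to R^k. *)
definition weak_conv_along ::
    "('n \<Rightarrow> 'b::topological_space measure) \<Rightarrow> 'b measure \<Rightarrow> 'n filter \<Rightarrow> bool" where
  "weak_conv_along \<mu> \<nu> F \<longleftrightarrow>
     (\<forall>g :: 'b \<Rightarrow> real. continuous_on (space \<nu>) g \<longrightarrow> bounded (g ` space \<nu>) \<longrightarrow>
        ((\<lambda>n. \<integral>x. g x \<partial>\<mu> n) \<longlongrightarrow> (\<integral>x. g x \<partial>\<nu>)) F)"

definition stationary_field ::
    "'w measure \<Rightarrow> (nat \<times> nat \<Rightarrow> 'w \<Rightarrow> 'a::topological_space) \<Rightarrow> bool" where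
  "stationary_field M X \<longleftrightarrow>
     (\<forall>t\<in>pos_idx. X t \<in> borel_measurable M) \<and>
     (\<forall>h1 h2. distr M (PiM pos_idx (\<lambda>_. borel)) (\<lambda>\<omega>. \<lambda>t\<in>pos_idx. X (fst t + h1, snd t + h2) \<omega>) =
              distr M (PiM pos_idx (\<lambda>_. borel)) (\<lambda>\<omega>. \<lambda>t\<in>pos_idx. X t \<omega>))"

(* An array of size l = (l1,l2) is the pair (l, x), with the entries x indexed by grid l. *)
type_synonym 'a arr = "(nat \<times> nat) \<times> (nat \<times> nat \<Rightarrow> 'a)"

definition arrays :: "'a set \<Rightarrow> 'a arr set" where
  "arrays E = (SIGMA l:pos_idx. PiE (grid l) (\<lambda>_. E))"

(* The disjoint union, over all sizes l, of the product sigma-fields on E-valued arrays of size l. *)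
definition array_space :: "'a::topological_space set \<Rightarrow> 'a arr measure" where
  "array_space E = sigma (arrays E)
     {B. B \<subseteq> arrays E \<and>
         (\<forall>l\<in>pos_idx. {x. (l, x) \<in> B} \<in> sets (PiM (grid l) (\<lambda>_. restrict_space borel E)))}"

lemma space_array_space: "space (array_space E) = arrays E"
  unfolding array_space_def by (rule space_measure_of) auto

lemma sets_array_space:
  "sets (array_space E) =
     {B. B \<subseteq> arrays E \<and>
         (\<forall>l\<in>pos_idx. {x. (l, x) \<in> B} \<in> sets (PiM (grid l) (\<lambda>_. restrict_space borel E)))}"
  (is "_ = ?S")
proof -
  have whole: "{x. (l, x) \<in> arrays E} = space (PiM (grid l) (\<lambda>_. restrict_space borel E))"
    if "l \<in> pos_idx" for l
    using that by (auto simp: arrays_def space_PiM space_restrict_space)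
  have "sigma_algebra (arrays E) ?S"
    unfolding sigma_algebra_iff2
  proof (intro conjI ballI allI impI)
    fix B assume B: "B \<in> ?S"
    have "{x. (l, x) \<in> arrays E - B} =
        space (PiM (grid l) (\<lambda>_. restrict_space borel E)) - {x. (l, x) \<in> B}"
      if "l \<in> pos_idx" for l
      unfolding whole[OF that, symmetric] by auto
    with B show "arrays E - B \<in> ?S" by auto
  next
    fix B :: "nat \<Rightarrow> _" assume "range B \<subseteq> ?S"
    moreover have "{x. (l, x) \<in> (\<Union>i. B i)} = (\<Union>i. {x. (l, x) \<in> B i})" for l by auto
    ultimately show "(\<Union>i. B i) \<in> ?S" by (auto simp: subset_eq)
  qed auto
  then show ?thesis
    unfolding array_space_def
    by (intro sigma_algebra.sets_measure_of_eq)
qed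

(* The array written 0 in "C(y) = 0" and "f(0) = 0". *)
definition zero_arr :: "'a::zero arr" where
  "zero_arr = ((1, 1), \<lambda>s\<in>grid (1, 1). 0)"

definition relevant :: "'a set \<Rightarrow> 'a arr \<Rightarrow> (nat \<times> nat) set" where
  "relevant A y = {s \<in> grid (fst y). snd y s \<in> A}"

definition rect :: "nat \<times> nat \<Rightarrow> nat \<times> nat \<Rightarrow> (nat \<times> nat) set" where
  "rect p q = {fst p..fst q} \<times> {snd p..snd q}"

(* The entries of y at the positions rect p q, re-indexed to start at (1,1). *)
definition subarray :: "'a arr \<Rightarrow> nat \<times> nat \<Rightarrow> nat \<times> nat \<Rightarrow> 'a arr" where
  "subarray y p q =
     (let l = (fst q + 1 - fst p, snd q + 1 - snd p)
      in (l, \<lambda>s\<in>grid l. snd y (fst p + fst s - 1, snd p + snd s - 1)))"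

definition lower_corner :: "(nat \<times> nat) set \<Rightarrow> nat \<times> nat" where
  "lower_corner R = (Min (fst ` R), Min (snd ` R))"

definition upper_corner :: "(nat \<times> nat) set \<Rightarrow> nat \<times> nat" where
  "upper_corner R = (Max (fst ` R), Max (snd ` R))"

lemma smallest_rect:
  assumes "finite R" "R \<noteq> {}"
  shows "R \<subseteq> rect (lower_corner R) (upper_corner R)"
    and "R \<subseteq> rect p q \<Longrightarrow> rect (lower_corner R) (upper_corner R) \<subseteq> rect p q"
proof -
  show "R \<subseteq> rect (lower_corner R) (upper_corner R)"
  proof
    fix s assume "s \<in> R"
    then have "fst s \<in> fst ` R" "snd s \<in> snd ` R" by auto
    then show "s \<in> rect (lower_corner R) (upper_corner R)"
      using assms by (simp add: rect_def lower_corner_def upper_corner_def mem_Times_iff)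
  qed
  assume sub: "R \<subseteq> rect p q"
  have "fst p \<le> Min (fst ` R)" "snd p \<le> Min (snd ` R)"
       "Max (fst ` R) \<le> fst q" "Max (snd ` R) \<le> snd q"
    using assms sub by (auto simp: rect_def mem_Times_iff subset_eq)
  then show "rect (lower_corner R) (upper_corner R) \<subseteq> rect p q"
    by (auto simp: rect_def lower_corner_def upper_corner_def)
qed

(* By smallest_rect, this is the smallest rectangular sub-array containing all entries in A. *)
definition core :: "'a::zero set \<Rightarrow> 'a arr \<Rightarrow> 'a arr" where
  "core A y =
     (if relevant A y = {} then zero_arr
      else subarray y (lower_corner (relevant A y)) (upper_corner (relevant A y)))"

definition cluster_functional ::
    "'a::{zero, topological_space} set \<Rightarrow> 'a set \<Rightarrow> ('a arr \<Rightarrow> real) \<Rightarrow> bool" where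
  "cluster_functional E A f \<longleftrightarrow>
     f \<in> borel_measurable (array_space E) \<and>
     (\<forall>y\<in>arrays E. f y = f (core A y)) \<and>
     f zero_arr = 0"

definition normalized ::
    "'a::real_vector set \<Rightarrow> (nat \<times> nat \<Rightarrow> 'a \<Rightarrow> 'a) \<Rightarrow> (nat \<times> nat \<Rightarrow> 'w \<Rightarrow> 'a) \<Rightarrow>
     nat \<times> nat \<Rightarrow> nat \<times> nat \<Rightarrow> 'w \<Rightarrow> 'a" where
  "normalized A L X n t \<omega> = indicator A (X t \<omega>) *\<^sub>R L n (X t \<omega>)"

(* The block with index u = (i,j), of size b = (r1,r2), of the field x. *)
definition block ::
    "nat \<times> nat \<Rightarrow> (nat \<times> nat \<Rightarrow> 'w \<Rightarrow> 'a) \<Rightarrow> nat \<times> nat \<Rightarrow> 'w \<Rightarrow> 'a arr" where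
  "block b x u \<omega> =
     (b, \<lambda>s\<in>grid b. x ((fst u - 1) * fst b + fst s, (snd u - 1) * snd b + snd s) \<omega>)"

(* In the next three definitions D is the set of block indices, Y the family of blocks and a the
   normalizing constant sqrt (n1 n2 v). *)
definition block_vector ::
    "'w measure \<Rightarrow> (nat \<times> nat \<Rightarrow> 'w \<Rightarrow> 'b) \<Rightarrow> real \<Rightarrow> (nat \<Rightarrow> 'b \<Rightarrow> real) \<Rightarrow>
     nat \<times> nat \<Rightarrow> 'w \<Rightarrow> nat \<Rightarrow> real" where
  "block_vector M Y a fs u \<omega> l = 1 / a * (fs l (Y u \<omega>) - (\<integral>\<omega>'. fs l (Y u \<omega>') \<partial>M))"

definition dep_coeff ::
    "'w measure \<Rightarrow> (nat \<times> nat) set \<Rightarrow> (nat \<times> nat \<Rightarrow> 'w \<Rightarrow> 'b) \<Rightarrow> real \<Rightarrow>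
     nat \<Rightarrow> (nat \<Rightarrow> real) \<Rightarrow> (nat \<Rightarrow> 'b \<Rightarrow> real) \<Rightarrow> real" where
  "dep_coeff M D Y a k t fs =
     (\<Sum>j\<in>D. cmod (cov M
        (\<lambda>\<omega>. iexp (\<Sum>l=1..k. t l *
            (\<Sum>u\<in>{u\<in>D. fst u > fst j \<or> fst u = fst j \<and> snd u > snd j}. block_vector M Y a fs u \<omega> l)))
        (\<lambda>\<omega>. iexp (\<Sum>l=1..k. t l * block_vector M Y a fs j \<omega> l))))"

definition empirical ::
    "'w measure \<Rightarrow> (nat \<times> nat) set \<Rightarrow> (nat \<times> nat \<Rightarrow> 'w \<Rightarrow> 'b) \<Rightarrow> real \<Rightarrow>
     ('b \<Rightarrow> real) \<Rightarrow> 'w \<Rightarrow> real" where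
  "empirical M D Y a f \<omega> = 1 / a * (\<Sum>j\<in>D. f (Y j \<omega>) - (\<integral>\<omega>'. f (Y j \<omega>') \<partial>M))"

(* Normal law on the real line; sd = 0 is the point mass at the mean. *)
definition normal_rv :: "'w measure \<Rightarrow> ('w \<Rightarrow> real) \<Rightarrow> bool" where
  "normal_rv N U \<longleftrightarrow> U \<in> borel_measurable N \<and>
     (\<exists>m sd. sd \<ge> 0 \<and>
        distr N borel U = (if sd = 0 then return borel m else density lborel (normal_density m sd)))"

definition gaussian_process :: "'w measure \<Rightarrow> 'i set \<Rightarrow> ('i \<Rightarrow> 'w \<Rightarrow> real) \<Rightarrow> bool" where
  "gaussian_process N I Z \<longleftrightarrow> prob_space N \<and>
     (\<forall>J a. finite J \<longrightarrow> J \<subseteq> I \<longrightarrow> normal_rv N (\<lambda>\<omega>. \<Sum>i\<in>J. a i * Z i \<omega>))"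

definition centered_gaussian_process ::
    "'w measure \<Rightarrow> 'i set \<Rightarrow> ('i \<Rightarrow> 'w \<Rightarrow> real) \<Rightarrow> ('i \<Rightarrow> 'i \<Rightarrow> real) \<Rightarrow> bool" where
  "centered_gaussian_process N I Z c \<longleftrightarrow> gaussian_process N I Z \<and>
     (\<forall>i\<in>I. (\<integral>\<omega>. Z i \<omega> \<partial>N) = 0) \<and> (\<forall>i\<in>I. \<forall>j\<in>I. cov N (Z i) (Z j) = c i j)"

definition fidi :: "'w measure \<Rightarrow> nat \<Rightarrow> (nat \<Rightarrow> 'w \<Rightarrow> real) \<Rightarrow> (nat \<Rightarrow> real) measure" where
  "fidi M k U = distr M (PiM {1..k} (\<lambda>_. borel)) (\<lambda>\<omega>. \<lambda>l\<in>{1..k}. U l \<omega>)"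

end

theory Submission
  imports Defs
begin

text \<open>
  Weak convergence of the finite-dimensional laws is a statement about characteristic functions.
  For a tuple of functionals and coefficients \<open>t\<close>, the linear combination of the values of the
  empirical process is a sum of variables \<open>W u\<close>, one for each block \<open>u\<close>. Removing the blocks one
  after the other in lexicographic order, the characteristic function of the sum differs from the
  product of those of the single blocks by at most the sum of covariances in the dependence
  coefficient (\<open>char_sum_factorization\<close>), which tends to 0. By stationarity all blocks have the same law
  (\<open>block_measurable_and_law\<close>), so the product is the power of one characteristic function, as if the
  blocks were independent. Lindeberg's argument gives its limit
  (\<open>multivariate_lindeberg_char_power\<close>): there are asymptotically \<open>n1 n2 / (r1 r2)\<close> blocks, each of
  variance \<open>r1 r2 v / (n1 n2 v)\<close> times a quantity with limit \<open>\<Sum> t l * t l' * c (f l) (f l')\<close>, and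
  the truncation condition on single functionals passes to linear combinations.

  Two general results complete the proof. The first is Levy's continuity theorem in several
  dimensions (\<open>multivariate_levy_continuity\<close>), proved from the theorem on the line, which provides
  tightness, and from the Stone-Weierstrass theorem; to approximate a bounded continuous function by
  trigonometric polynomials with control on the whole space, the space is first folded onto a box by
  a triangle wave. Its consequence that a characteristic function determines the law
  (\<open>joint_char_determines_measure\<close>) gives the second result, the existence of the limit process
  (\<open>centered_gaussian_process_exists\<close>): \<open>c\<close> is positive semidefinite as a limit of covariances, finite
  Gaussian vectors are linear images of independent normal variables through a Gram representation of
  \<open>c\<close> (\<open>psd_gram\<close>), and uniqueness makes their laws consistent, so that Kolmogorov's extension theorem
  applies to the whole class of functionals, however large.
\<close>

section \<open>Characteristic functions and weak convergence in several dimensions\<close>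

lemma norm_integral_le:
  fixes f :: "'w \<Rightarrow> 'b::{banach, second_countable_topology}"
  assumes "integrable M f" "integrable M g" "\<And>x. x \<in> space M \<Longrightarrow> norm (f x) \<le> g x"
  shows "norm (\<integral>x. f x \<partial>M) \<le> (\<integral>x. g x \<partial>M)"
  by (rule order_trans[OF integral_norm_bound integral_mono]) (use assms in auto)

definition joint_char :: "'i set \<Rightarrow> ('i \<Rightarrow> real) measure \<Rightarrow> ('i \<Rightarrow> real) \<Rightarrow> complex" where
  "joint_char I \<mu> t = (CLINT x|\<mu>. iexp (\<Sum>i\<in>I. t i * x i))"

text \<open>These functions play the role of the trigonometric polynomials. Their integrals are finite
  linear combinations of values of \<^const>\<open>joint_char\<close>, hence converge as soon as the characteristic
  functions do. They form an algebra, as the Stone-Weierstrass theorem requires, because a product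
  of two waves is a wave.\<close>
inductive trig_poly :: "'i set \<Rightarrow> (('i \<Rightarrow> real) \<Rightarrow> complex) \<Rightarrow> bool" for I where
  wave: "trig_poly I (\<lambda>x. c * iexp (\<Sum>i\<in>I. t i * x i))"
| add: "trig_poly I p \<Longrightarrow> trig_poly I q \<Longrightarrow> trig_poly I (\<lambda>x. p x + q x)"

lemma trig_poly_wave_mult:
  assumes "trig_poly I q"
  shows "trig_poly I (\<lambda>x. c * iexp (\<Sum>i\<in>I. t i * x i) * q x)"
  using assms
proof induction
  case (wave d s)
  have "(\<lambda>x. c * iexp (\<Sum>i\<in>I. t i * x i) * (d * iexp (\<Sum>i\<in>I. s i * x i))) =
      (\<lambda>x. (c * d) * iexp (\<Sum>i\<in>I. (t i + s i) * x i))"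
    by (simp add: fun_eq_iff exp_add[symmetric] algebra_simps sum.distrib mult_exp_exp)
  then show ?case
    using trig_poly.wave[of I "c * d" "\<lambda>i. t i + s i"] by simp
next
  case (add p q)
  then show ?case using trig_poly.add by (fastforce simp: distrib_left)
qed

lemma trig_poly_mult:
  assumes "trig_poly I p" "trig_poly I q"
  shows "trig_poly I (\<lambda>x. p x * q x)"
  using assms
proof induction
  case (wave c t)
  then show ?case by (rule trig_poly_wave_mult)
next
  case (add p p')
  then show ?case using trig_poly.add by (fastforce simp: distrib_right)
qed

lemma trig_poly_const: "trig_poly I (\<lambda>x. c)"
  using trig_poly.wave[of I c "\<lambda>_. 0"] by simp

lemma trig_poly_sin:
  assumes "finite I" "l \<in> I"
  shows "trig_poly I (\<lambda>x. of_real (sin (x l / m)))"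
proof -
  have s: "(\<Sum>i\<in>I. (if i = l then d else 0) * x i) = d * x l" for x :: "_ \<Rightarrow> real" and d :: real
    using assms by (simp add: if_distrib[of "\<lambda>z. z * _"] cong: if_cong)
  have "trig_poly I (\<lambda>x. (- \<i> / 2) * iexp (\<Sum>i\<in>I. (if i = l then 1 / m else 0) * x i) +
      (\<i> / 2) * iexp (\<Sum>i\<in>I. (if i = l then - 1 / m else 0) * x i))"
    by (intro trig_poly.intros)
  moreover have "(\<lambda>x. (- \<i> / 2) * iexp (\<Sum>i\<in>I. (if i = l then 1 / m else 0) * x i) +
      (\<i> / 2) * iexp (\<Sum>i\<in>I. (if i = l then - 1 / m else 0) * x i)) = (\<lambda>x. of_real (sin (x l / m)))"
    unfolding s by (rule ext) (simp add: complex_eq_iff Re_exp Im_exp)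
  ultimately show ?thesis by simp
qed

lemma trig_poly_measurable:
  assumes "trig_poly I p"
  shows "p \<in> borel_measurable (PiM I (\<lambda>_. borel))"
  using assms by induction measurable

lemma trig_poly_bounded:
  assumes "trig_poly I p"
  shows "\<exists>B. \<forall>x. cmod (p x) \<le> B"
  using assms
proof induction
  case (wave c t)
  then show ?case by (intro exI[of _ "cmod c"]) (simp add: norm_mult)
next
  case (add p q)
  then obtain B C where "\<And>x. cmod (p x) \<le> B" "\<And>x. cmod (q x) \<le> C" by auto
  then show ?case
    by (intro exI[of _ "B + C"] allI) (metis add_mono norm_triangle_ineq order_trans)
qed

lemma trig_poly_integrable:
  assumes "trig_poly I p" "prob_space \<mu>" "sets \<mu> = sets (PiM I (\<lambda>_. borel))"
  shows "integrable \<mu> p"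
proof -
  interpret prob_space \<mu> by fact
  obtain B where "\<And>x. cmod (p x) \<le> B" using trig_poly_bounded[OF assms(1)] by auto
  moreover have "p \<in> borel_measurable \<mu>"
    using trig_poly_measurable[OF assms(1)] by (simp cong: measurable_cong_sets add: assms(3))
  ultimately show ?thesis by (intro integrable_const_bound[of _ B]) auto
qed

lemma trig_poly_integral_tendsto:
  assumes "trig_poly I p"
    and \<mu>: "\<And>n. prob_space (\<mu> n)" "\<And>n. sets (\<mu> n) = sets (PiM I (\<lambda>_. borel))"
    and \<nu>: "prob_space \<nu>" "sets \<nu> = sets (PiM I (\<lambda>_. borel))"
    and conv: "\<And>t. (\<lambda>n. joint_char I (\<mu> n) t) \<longlonglongrightarrow> joint_char I \<nu> t"
  shows "(\<lambda>n. CLINT x|\<mu> n. p x) \<longlonglongrightarrow> (CLINT x|\<nu>. p x)"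
  using assms(1)
proof induction
  case (wave c t)
  then show ?case using tendsto_mult_left[OF conv[of t], of c] by (simp add: joint_char_def)
next
  case (add p q)
  then show ?case
    by (simp add: trig_poly_integrable \<mu> \<nu> tendsto_add)
qed

text \<open>Each coordinate passes through a triangle wave that is the identity on
  \<open>[- m * pi / 2, m * pi / 2]\<close>. The point of this map is that it depends on \<open>x i\<close> only through
  \<open>sin (x i / m)\<close>: replacing \<open>g\<close> by \<open>g\<close> after folding changes nothing on a large box, does not
  increase the bound of \<open>g\<close> elsewhere, and yields a function within reach of uniform approximation
  by trigonometric polynomials on the whole space.\<close>
definition fold_box :: "'i set \<Rightarrow> real \<Rightarrow> ('i \<Rightarrow> real) \<Rightarrow> 'i \<Rightarrow> real" where
  "fold_box I m x = (\<lambda>i\<in>I. m * arcsin (sin (x i / m)))"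

lemma fold_box_id:
  assumes "m > 0" "x \<in> PiE I (\<lambda>_. UNIV)" "\<And>i. i \<in> I \<Longrightarrow> \<bar>x i\<bar> \<le> m * pi / 2"
  shows "fold_box I m x = x"
proof
  fix i
  show "fold_box I m x i = x i"
  proof (cases "i \<in> I")
    case True
    then have "\<bar>x i\<bar> \<le> m * pi / 2" by (rule assms)
    then have "arcsin (sin (x i / m)) = x i / m"
      using assms(1) by (intro arcsin_sin) (auto simp: field_simps abs_le_iff)
    then show ?thesis using True assms(1) by (simp add: fold_box_def)
  qed (use assms(2) in \<open>auto simp: fold_box_def PiE_def extensional_def\<close>)
qed

lemma compact_PiE_cube: "compact (PiE I (\<lambda>_. {-1..1::real}))" for I :: "'i set"
proof -
  have "PiE I (\<lambda>_. {-1..1::real}) = PiE UNIV (\<lambda>i. if i \<in> I then {-1..1} else {undefined})"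
    by (auto simp: PiE_def Pi_def extensional_def split: if_splits)
  moreover have "compactin (product_topology (\<lambda>_. euclidean) UNIV)
      (PiE UNIV (\<lambda>i. if i \<in> I then {-1..1::real} else {undefined}))"
    by (subst compactin_PiE) auto
  ultimately show ?thesis
    by (simp add: euclidean_product_topology)
qed

text \<open>The folded function is \<open>g (m * arcsin y)\<close> at \<open>y = sin (x / m)\<close>. Here \<open>y\<close> ranges over a compact
  cube, on which Stone-Weierstrass applies with the functions that become trigonometric polynomials
  in \<open>x\<close>; the coordinates of \<open>y\<close> are among them and separate points. An approximation that is
  uniform in \<open>y\<close> is uniform in all of \<open>x\<close>.\<close>
lemma fold_box_trig_approx:
  fixes I :: "nat set" and g :: "(nat \<Rightarrow> real) \<Rightarrow> real"
  assumes "finite I" "m > 0" "\<epsilon> > 0" and cont: "continuous_on (PiE I (\<lambda>_. UNIV)) g"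
  shows "\<exists>p. trig_poly I p \<and> (\<forall>x. cmod (of_real (g (fold_box I m x)) - p x) < \<epsilon>)"
proof -
  define S where "S = PiE I (\<lambda>_. {-1..1::real})"
  define s where "s x = (\<lambda>i\<in>I. sin (x i / m))" for x :: "nat \<Rightarrow> real"
  define R where "R = {h :: (nat \<Rightarrow> real) \<Rightarrow> real. continuous_on S h \<and>
      trig_poly I (\<lambda>x. of_real (h (s x)))}"
  define w where "w y = (\<lambda>i\<in>I. m * arcsin (y i))" for y :: "nat \<Rightarrow> real"
  have R_I: "h \<in> R" if "continuous_on S h" "trig_poly I (\<lambda>x. of_real (h (s x)))" for h
    using that by (simp add: R_def)
  have R_D: "continuous_on S h" "trig_poly I (\<lambda>x. of_real (h (s x)))" if "h \<in> R" for h
    using that by (simp_all add: R_def)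
  interpret function_ring_on R S
  proof
    fix h h' assume hh: "h \<in> R" "h' \<in> R"
    show "(\<lambda>x. h x + h' x) \<in> R"
      using trig_poly.add[OF R_D(2)[OF hh(1)] R_D(2)[OF hh(2)]]
      by (intro R_I continuous_on_add R_D(1)[OF hh(1)] R_D(1)[OF hh(2)]) simp
    show "(\<lambda>x. h x * h' x) \<in> R"
      using trig_poly_mult[OF R_D(2)[OF hh(1)] R_D(2)[OF hh(2)]]
      by (intro R_I continuous_on_mult R_D(1)[OF hh(1)] R_D(1)[OF hh(2)]) simp
  next
    show "continuous_on S h" if "h \<in> R" for h using that by (rule R_D)
    show "(\<lambda>_. c) \<in> R" for c by (intro R_I continuous_on_const trig_poly_const)
    show "compact S" unfolding S_def by (rule compact_PiE_cube)
    show "\<exists>h\<in>R. h x \<noteq> h y" if xy: "x \<in> S" "y \<in> S" "x \<noteq> y" for x y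
    proof -
      obtain i where i: "i \<in> I" "x i \<noteq> y i"
        using xy PiE_ext[of x I "\<lambda>_. {-1..1}" y] by (auto simp: S_def)
      have "continuous_on S (\<lambda>x. x i)"
        by (rule continuous_on_subset[OF continuous_on_product_coordinates]) simp
      moreover have "trig_poly I (\<lambda>x. of_real (s x i))"
        using trig_poly_sin[OF assms(1) i(1), of m] i(1) by (simp add: s_def)
      ultimately have "(\<lambda>x. x i) \<in> R" by (rule R_I)
      then show ?thesis using i(2) by (intro bexI[of _ "\<lambda>x. x i"])
    qed
  qed
  have "continuous_on S w"
  proof (rule continuous_on_coordinatewise_then_product)
    fix i
    show "continuous_on S (\<lambda>x. w x i)"
    proof (cases "i \<in> I")
      case True
      have "continuous_on S (\<lambda>x. m * arcsin (x i))"
      proof (intro continuous_on_mult continuous_on_const continuous_on_arcsin)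
        show "continuous_on S (\<lambda>x. x i)"
          by (rule continuous_on_subset[OF continuous_on_product_coordinates]) simp
        show "\<forall>x\<in>S. - 1 \<le> x i \<and> x i \<le> 1" using True by (auto simp: S_def PiE_iff)
      qed
      then show ?thesis using True by (simp add: w_def)
    qed (simp add: w_def)
  qed
  moreover have "w ` S \<subseteq> PiE I (\<lambda>_. UNIV)" by (auto simp: w_def)
  ultimately have "continuous_on S (\<lambda>y. g (w y))"
    using cont by (intro continuous_on_compose2[of _ g S w])
  from Stone_Weierstrass_basic[OF this \<open>\<epsilon> > 0\<close>] obtain h where
    h: "h \<in> R" "\<And>y. y \<in> S \<Longrightarrow> \<bar>g (w y) - h y\<bar> < \<epsilon>" by blast
  have "s x \<in> S" for x
    unfolding s_def S_def by (rule restrict_PiE_iff[THEN iffD2]) simp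
  moreover have "w (s x) = fold_box I m x" for x
    unfolding w_def s_def fold_box_def by (rule restrict_ext) simp
  ultimately have "\<bar>g (fold_box I m x) - h (s x)\<bar> < \<epsilon>" for x
    using h(2)[of "s x"] by simp
  moreover have "cmod (of_real a - of_real b) = \<bar>a - b\<bar>" for a b
    by (metis norm_of_real of_real_diff)
  ultimately have "trig_poly I (\<lambda>x. of_real (h (s x))) \<and>
    (\<forall>x. cmod (of_real (g (fold_box I m x)) - of_real (h (s x))) < \<epsilon>)"
    using h(1) by (simp add: R_def)
  then show ?thesis by blast
qed

lemma fold_box_measurable:
  fixes I :: "nat set" and g :: "(nat \<Rightarrow> real) \<Rightarrow> real"
  assumes "finite I" "m > 0" and cont: "continuous_on (PiE I (\<lambda>_. UNIV)) g"
  shows "(\<lambda>x. g (fold_box I m x)) \<in> borel_measurable (PiM I (\<lambda>_. borel))"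
proof -
  have "\<forall>j. \<exists>p. trig_poly I p \<and> (\<forall>x. cmod (of_real (g (fold_box I m x)) - p x) < 1 / real (Suc j))"
    using fold_box_trig_approx[OF assms(1,2) _ cont] by simp
  then obtain p where p: "\<And>j. trig_poly I (p j)"
    "\<And>j x. cmod (of_real (g (fold_box I m x)) - p j x) < 1 / real (Suc j)" by metis
  have "(\<lambda>j. p j x) \<longlonglongrightarrow> complex_of_real (g (fold_box I m x))" for x
  proof (rule LIM_zero_cancel, rule Lim_null_comparison)
    show "\<forall>\<^sub>F j in sequentially. cmod (p j x - complex_of_real (g (fold_box I m x))) \<le> 1 / real (Suc j)"
      using p(2)[of x] by (intro always_eventually allI) (subst norm_minus_commute, rule less_imp_le)
    show "(\<lambda>j. 1 / real (Suc j)) \<longlonglongrightarrow> 0"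
      using LIMSEQ_inverse_real_of_nat by (simp add: inverse_eq_divide)
  qed
  then have "(\<lambda>x. complex_of_real (g (fold_box I m x))) \<in> borel_measurable (PiM I (\<lambda>_. borel))"
    by (rule borel_measurable_LIMSEQ_metric[where f = p, OF trig_poly_measurable[OF p(1)]])
  then have "(\<lambda>x. Re (complex_of_real (g (fold_box I m x)))) \<in> borel_measurable (PiM I (\<lambda>_. borel))"
    by measurable
  then show ?thesis by simp
qed

text \<open>Continuity refers to the product topology and measurability to the product \<open>\<sigma>\<close>-field. The link
  is again folding: \<open>g\<close> is the pointwise limit of its folded versions, and these are uniform limits of
  trigonometric polynomials.\<close>
lemma continuous_on_PiE_measurable:
  fixes I :: "nat set" and g :: "(nat \<Rightarrow> real) \<Rightarrow> real"
  assumes "finite I" and cont: "continuous_on (PiE I (\<lambda>_. UNIV)) g"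
  shows "g \<in> borel_measurable (PiM I (\<lambda>_. borel))"
proof (rule borel_measurable_LIMSEQ_metric)
  show "(\<lambda>x. g (fold_box I (real (Suc j)) x)) \<in> borel_measurable (PiM I (\<lambda>_. borel))" for j
    by (rule fold_box_measurable[OF assms(1) _ cont]) simp
  fix x assume "x \<in> space (PiM I (\<lambda>_. borel :: real measure))"
  then have x: "x \<in> PiE I (\<lambda>_. UNIV)" by (simp add: space_PiM)
  obtain N :: nat where N: "(\<Sum>i\<in>I. \<bar>x i\<bar>) \<le> N" using real_arch_simple by blast
  have "\<forall>\<^sub>F j in sequentially. g (fold_box I (real (Suc j)) x) = g x"
  proof (rule eventually_sequentiallyI[of N])
    fix j assume "N \<le> j"
    have "\<bar>x i\<bar> \<le> real (Suc j) * pi / 2" if "i \<in> I" for i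
    proof -
      have "\<bar>x i\<bar> \<le> (\<Sum>i\<in>I. \<bar>x i\<bar>)" using that assms(1) by (intro member_le_sum) auto
      also have "\<dots> \<le> real (Suc j) * 1" using N \<open>N \<le> j\<close> by simp
      also have "\<dots> \<le> real (Suc j) * (pi / 2)"
        by (intro mult_left_mono) (use pi_ge_two in auto)
      finally show ?thesis by simp
    qed
    then have "fold_box I (real (Suc j)) x = x"
      by (intro fold_box_id x) simp
    then show "g (fold_box I (real (Suc j)) x) = g x" by simp
  qed
  then show "(\<lambda>j. g (fold_box I (real (Suc j)) x)) \<longlonglongrightarrow> g x"
    by (rule tendsto_eventually)
qed


text \<open>A continuous cut-off: it vanishes for \<open>\<bar>y\<bar> \<le> K - 1\<close> and is 1 for \<open>\<bar>y\<bar> \<ge> K\<close>.\<close>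
definition ramp :: "real \<Rightarrow> real \<Rightarrow> real" where
  "ramp K y = max 0 (min 1 (\<bar>y\<bar> - K + 1))"

lemma ramp_bounds: "0 \<le> ramp K y" "ramp K y \<le> 1"
  by (auto simp: ramp_def)

lemma continuous_ramp: "continuous_on S (ramp K)"
  unfolding ramp_def by (intro continuous_intros)

lemma ramp_measurable[measurable]: "ramp K \<in> borel_measurable borel"
  by (rule borel_measurable_continuous_onI[OF continuous_ramp])

lemma ramp_tendsto: "(\<lambda>N. ramp (real N) y) \<longlonglongrightarrow> 0"
proof (rule tendsto_eventually, rule eventually_sequentiallyI[of "nat \<lceil>\<bar>y\<bar>\<rceil> + 1"])
  fix N assume "nat \<lceil>\<bar>y\<bar>\<rceil> + 1 \<le> N"
  then have "\<bar>y\<bar> + 1 \<le> real N" by linarith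
  then show "ramp (real N) y = 0" by (simp add: ramp_def)
qed

text \<open>The joint characteristic function at multiples of a unit vector is the characteristic function of
  one coordinate, so Levy's theorem on the line applies. It supplies the tightness that the
  multivariate theorem needs.\<close>
lemma marginal_integral_tendsto:
  fixes \<mu> :: "nat \<Rightarrow> ('i \<Rightarrow> real) measure" and g :: "real \<Rightarrow> real"
  assumes I: "finite I" "i \<in> I"
    and \<mu>: "\<And>n. prob_space (\<mu> n)" "\<And>n. sets (\<mu> n) = sets (PiM I (\<lambda>_. borel))"
    and \<nu>: "prob_space \<nu>" "sets \<nu> = sets (PiM I (\<lambda>_. borel))"
    and conv: "\<And>t. (\<lambda>n. joint_char I (\<mu> n) t) \<longlonglongrightarrow> joint_char I \<nu> t"
    and g: "\<And>y. isCont g y" "\<And>y. \<bar>g y\<bar> \<le> B"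
  shows "(\<lambda>n. \<integral>x. g (x i) \<partial>\<mu> n) \<longlonglongrightarrow> (\<integral>x. g (x i) \<partial>\<nu>)"
proof -
  have meas: "(\<lambda>x. x i) \<in> borel_measurable \<rho>" if "sets \<rho> = sets (PiM I (\<lambda>_. borel))" for \<rho> :: "('i \<Rightarrow> real) measure"
    using measurable_component_singleton[of i I "\<lambda>_. borel :: real measure"] I(2)
    by (simp add: measurable_cong_sets[OF that refl])
  have s: "(\<Sum>j\<in>I. (if j = i then s else 0) * x j) = s * x i" for x :: "_ \<Rightarrow> real" and s :: real
    using I by (simp add: if_distrib[of "\<lambda>z. z * _"] cong: if_cong)
  have char: "char (distr \<rho> borel (\<lambda>x. x i)) s = joint_char I \<rho> (\<lambda>j. if j = i then s else 0)"
    if "sets \<rho> = sets (PiM I (\<lambda>_. borel))" for \<rho> s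
    unfolding char_def joint_char_def using meas[OF that] by (simp add: integral_distr s)
  have rd: "real_distribution (distr \<rho> borel (\<lambda>x. x i))"
    if "prob_space \<rho>" "sets \<rho> = sets (PiM I (\<lambda>_. borel))" for \<rho>
    using prob_space.real_distribution_distr[OF that(1)] meas[OF that(2)] by simp
  have "weak_conv_m (\<lambda>n. distr (\<mu> n) borel (\<lambda>x. x i)) (distr \<nu> borel (\<lambda>x. x i))"
    using conv by (intro levy_continuity rd \<mu> \<nu>) (simp add: char \<mu> \<nu>)
  then have "(\<lambda>n. \<integral>y. g y \<partial>distr (\<mu> n) borel (\<lambda>x. x i)) \<longlonglongrightarrow> (\<integral>y. g y \<partial>distr \<nu> borel (\<lambda>x. x i))"
    by (intro weak_conv_imp_integral_bdd_continuous_conv[where B = B] rd \<mu> \<nu> g) (simp_all add: g)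
  moreover have "g \<in> borel_measurable borel"
    using g(1) by (intro borel_measurable_continuous_onI continuous_at_imp_continuous_on) simp
  ultimately show ?thesis
    by (simp add: integral_distr[OF meas[OF \<mu>(2)]] integral_distr[OF meas[OF \<nu>(2)]])
qed

text \<open>Three approximations are combined. Folding at a box of half-width \<open>N\<close> changes \<open>\<integral> g\<close> by at most
  \<open>2 B\<close> times the expected number of coordinates outside the box, measured by \<^const>\<open>ramp\<close>; this is
  small under the limit law for large \<open>N\<close>, and then, by convergence of the marginals, also under
  \<open>\<mu> n\<close> for all large \<open>n\<close>. The folded function is uniformly close to a trigonometric polynomial,
  whose integrals converge by hypothesis.\<close>
theorem multivariate_levy_continuity:
  fixes \<mu> :: "nat \<Rightarrow> (nat \<Rightarrow> real) measure" and g :: "(nat \<Rightarrow> real) \<Rightarrow> real"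
  assumes I: "finite I"
    and \<mu>: "\<And>n. prob_space (\<mu> n)" "\<And>n. sets (\<mu> n) = sets (PiM I (\<lambda>_. borel))"
    and \<nu>: "prob_space \<nu>" "sets \<nu> = sets (PiM I (\<lambda>_. borel))"
    and conv: "\<And>t. (\<lambda>n. joint_char I (\<mu> n) t) \<longlonglongrightarrow> joint_char I \<nu> t"
    and cont: "continuous_on (PiE I (\<lambda>_. UNIV)) g"
    and bdd: "bounded (g ` PiE I (\<lambda>_. UNIV))"
  shows "(\<lambda>n. \<integral>x. g x \<partial>\<mu> n) \<longlonglongrightarrow> (\<integral>x. g x \<partial>\<nu>)"
proof (rule LIMSEQ_I)
  fix e :: real assume "e > 0"
  obtain B where B: "B > 0" "\<And>x. x \<in> PiE I (\<lambda>_. UNIV) \<Longrightarrow> \<bar>g x\<bar> \<le> B"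
    using bdd by (auto simp: bounded_pos)
  define \<Psi> where "\<Psi> K x = (\<Sum>i\<in>I. ramp K (x i))" for K and x :: "nat \<Rightarrow> real"
  have \<Psi>_meas: "\<Psi> K \<in> borel_measurable \<rho>" if "sets \<rho> = sets (PiM I (\<lambda>_. borel))" for K \<rho>
    unfolding \<Psi>_def measurable_cong_sets[OF that refl] by measurable
  have \<Psi>_bd: "0 \<le> \<Psi> K x" "\<Psi> K x \<le> card I" for K x
    using sum_bounded_above[of I "\<lambda>i. ramp K (x i)" 1]
    by (auto simp: \<Psi>_def ramp_bounds intro!: sum_nonneg)
  have space: "space \<rho> = PiE I (\<lambda>_. UNIV)" if "sets \<rho> = sets (PiM I (\<lambda>_. borel))" for \<rho> :: "(nat \<Rightarrow> real) measure"
    using sets_eq_imp_space_eq[OF that] by (simp add: space_PiM)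
  have bint: "integrable \<rho> h" if "prob_space \<rho>" "sets \<rho> = sets (PiM I (\<lambda>_. borel))"
      "h \<in> borel_measurable (PiM I (\<lambda>_. borel))" "\<And>x. x \<in> PiE I (\<lambda>_. UNIV) \<Longrightarrow> \<bar>h x\<bar> \<le> C" for C :: real and \<rho> :: "(nat \<Rightarrow> real) measure" and h
  proof -
    interpret prob_space \<rho> by fact
    show ?thesis
    proof (rule integrable_const_bound[of _ C])
      show "AE x in \<rho>. norm (h x) \<le> C"
        by (rule AE_I2) (simp add: space[OF that(2)] that(4))
      show "h \<in> borel_measurable \<rho>"
        using that(3) by (simp add: measurable_cong_sets[OF that(2) refl])
    qed
  qed
  have \<Psi>_int: "integrable \<rho> (\<Psi> K)" if "prob_space \<rho>" "sets \<rho> = sets (PiM I (\<lambda>_. borel))" for \<rho> K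
    by (rule bint[OF that, of _ "card I"]) (use \<Psi>_meas \<Psi>_bd in \<open>auto simp: abs_of_nonneg\<close>)
  \<comment> \<open>little mass of the limit law lies outside a large box\<close>
  have "(\<lambda>N. \<integral>x. \<Psi> (real N) x \<partial>\<nu>) \<longlonglongrightarrow> (\<integral>x. 0 \<partial>\<nu>)"
  proof (rule integral_dominated_convergence[where w = "\<lambda>_. real (card I)"])
    have "(\<lambda>N. \<Psi> (real N) x) \<longlonglongrightarrow> (\<Sum>i\<in>I. 0)" for x
      unfolding \<Psi>_def by (intro tendsto_sum ramp_tendsto)
    then show "AE x in \<nu>. (\<lambda>N. \<Psi> (real N) x) \<longlonglongrightarrow> 0" by simp
    show "integrable \<nu> (\<lambda>_. real (card I))"
      using prob_space.finite_measure[OF \<nu>(1)] by (simp add: finite_measure.integrable_const)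
  qed (use \<Psi>_bd in \<open>auto intro!: \<Psi>_meas \<nu> simp: abs_of_nonneg\<close>)
  then have "(\<lambda>N. \<integral>x. \<Psi> (real N) x \<partial>\<nu>) \<longlonglongrightarrow> 0" by simp
  moreover have "0 < e / (16 * B)" using \<open>e > 0\<close> B(1) by simp
  ultimately have "\<forall>\<^sub>F N in sequentially. (\<integral>x. \<Psi> (real N) x \<partial>\<nu>) < e / (16 * B)"
    by (rule order_tendstoD)
  from eventually_conj[OF this eventually_gt_at_top[of 0]]
  obtain N :: nat where N: "(\<integral>x. \<Psi> (real N) x \<partial>\<nu>) < e / (16 * B)" "N > 0"
    unfolding eventually_sequentially by auto
  \<comment> \<open>the parameter for which folding is the identity exactly on the box of half-width N\<close>
  define m where "m = 2 * real N / pi"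
  define h where "h x = g (fold_box I m x)" for x
  have m: "m > 0" "m * pi / 2 = real N" using N(2) by (simp_all add: m_def)
  have fold_in: "fold_box I m x \<in> PiE I (\<lambda>_. UNIV)" for x by (simp add: fold_box_def)
  have h_bd: "\<bar>h x\<bar> \<le> B" for x unfolding h_def by (rule B(2)[OF fold_in])
  have h_meas: "h \<in> borel_measurable (PiM I (\<lambda>_. borel))"
    unfolding h_def by (rule fold_box_measurable[OF I m(1) cont])
  have g_meas: "g \<in> borel_measurable (PiM I (\<lambda>_. borel))"
    by (rule continuous_on_PiE_measurable[OF I cont])
  have gh: "\<bar>g x - h x\<bar> \<le> 2 * B * \<Psi> (real N) x" if x: "x \<in> PiE I (\<lambda>_. UNIV)" for x
  proof (cases "\<forall>i\<in>I. \<bar>x i\<bar> \<le> real N")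
    case True
    then have "h x = g x" unfolding h_def using fold_box_id[OF m(1) x] m(2) by simp
    then show ?thesis using B(1) \<Psi>_bd by simp
  next
    case False
    then obtain i where i: "i \<in> I" "\<bar>x i\<bar> > real N" by auto
    then have "ramp (real N) (x i) = 1" by (simp add: ramp_def)
    moreover have "ramp (real N) (x i) \<le> \<Psi> (real N) x"
      unfolding \<Psi>_def using i(1) I ramp_bounds by (intro member_le_sum) auto
    ultimately have "2 * B * 1 \<le> 2 * B * \<Psi> (real N) x" using B(1) by (intro mult_left_mono) auto
    moreover have "\<bar>g x - h x\<bar> \<le> 2 * B" using B(2)[OF x] h_bd[of x] by linarith
    ultimately show ?thesis by linarith
  qed
  have gh_int: "\<bar>(\<integral>x. g x \<partial>\<rho>) - (\<integral>x. h x \<partial>\<rho>)\<bar> \<le> 2 * B * (\<integral>x. \<Psi> (real N) x \<partial>\<rho>)"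
    if \<rho>: "prob_space \<rho>" "sets \<rho> = sets (PiM I (\<lambda>_. borel))" for \<rho>
  proof -
    have ints: "integrable \<rho> g" "integrable \<rho> h"
      using bint[OF \<rho> g_meas B(2)] bint[OF \<rho> h_meas h_bd] by auto
    have "\<bar>\<integral>x. g x - h x \<partial>\<rho>\<bar> \<le> (\<integral>x. 2 * B * \<Psi> (real N) x \<partial>\<rho>)"
      unfolding real_norm_def[symmetric]
      by (rule norm_integral_le)
        (use ints \<Psi>_int[OF \<rho>] gh in \<open>simp_all add: space[OF \<rho>(2)]\<close>)
    then show ?thesis using ints by simp
  qed
  \<comment> \<open>one trigonometric polynomial serves all laws, since the approximation is uniform on the space\<close>
  have "\<exists>p. trig_poly I p \<and> (\<forall>x. cmod (of_real (h x) - p x) < e / 16)"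
    unfolding h_def using \<open>e > 0\<close> by (intro fold_box_trig_approx[OF I m(1) _ cont]) simp
  then obtain p where p: "trig_poly I p" "\<And>x. cmod (of_real (h x) - p x) < e / 16" by blast
  have hp: "cmod (of_real (\<integral>x. h x \<partial>\<rho>) - (CLINT x|\<rho>. p x)) \<le> e / 16"
    if \<rho>: "prob_space \<rho>" "sets \<rho> = sets (PiM I (\<lambda>_. borel))" for \<rho>
  proof -
    interpret prob_space \<rho> by fact
    have ints: "integrable \<rho> (\<lambda>x. complex_of_real (h x))" "integrable \<rho> p"
      using bint[OF \<rho> h_meas h_bd] trig_poly_integrable[OF p(1) \<rho>] by auto
    have "cmod (CLINT x|\<rho>. of_real (h x) - p x) \<le> (\<integral>x. e / 16 \<partial>\<rho>)"
      using ints p(2) by (intro norm_integral_le) (auto intro: less_imp_le)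
    then show ?thesis using ints by (simp add: prob_space)
  qed
  have "\<forall>\<^sub>F n in sequentially. cmod ((CLINT x|\<mu> n. p x) - (CLINT x|\<nu>. p x)) < e / 16"
    using tendstoD[OF trig_poly_integral_tendsto[OF p(1) \<mu> \<nu> conv], of "e / 16"] \<open>e > 0\<close>
    by (simp add: dist_norm)
  moreover have "(\<lambda>n. \<integral>x. \<Psi> (real N) x \<partial>\<mu> n) \<longlonglongrightarrow> (\<integral>x. \<Psi> (real N) x \<partial>\<nu>)"
  proof -
    have r: "integrable \<rho> (\<lambda>x. ramp (real N) (x i))"
      if "i \<in> I" "prob_space \<rho>" "sets \<rho> = sets (PiM I (\<lambda>_. borel))" for \<rho> i
      by (rule bint[OF that(2,3), of _ 1]) (use that(1) ramp_bounds in \<open>auto simp: abs_of_nonneg\<close>)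
    have "(\<lambda>n. \<integral>x. ramp (real N) (x i) \<partial>\<mu> n) \<longlonglongrightarrow> (\<integral>x. ramp (real N) (x i) \<partial>\<nu>)" if "i \<in> I" for i
      by (rule marginal_integral_tendsto[OF I that \<mu> \<nu> conv, where B = 1])
        (use continuous_ramp[of UNIV] ramp_bounds in \<open>auto simp: continuous_on_eq_continuous_at abs_of_nonneg\<close>)
    then show ?thesis
      unfolding \<Psi>_def using r \<mu> \<nu> by (simp add: Bochner_Integration.integral_sum tendsto_sum)
  qed
  then have "\<forall>\<^sub>F n in sequentially. (\<integral>x. \<Psi> (real N) x \<partial>\<mu> n) < e / (16 * B)"
    using N(1) by (rule order_tendstoD)
  ultimately have "\<forall>\<^sub>F n in sequentially. norm ((\<integral>x. g x \<partial>\<mu> n) - (\<integral>x. g x \<partial>\<nu>)) < e"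
  proof eventually_elim
    case (elim n)
    have b: "2 * B * z < e / 8" if "z < e / (16 * B)" for z
    proof -
      have "2 * B * z < 2 * B * (e / (16 * B))"
        using that B(1) by (intro mult_strict_left_mono) auto
      also have "\<dots> = e / 8" using B(1) by simp
      finally show ?thesis .
    qed
    have "cmod (of_real (\<integral>x. h x \<partial>\<mu> n) - of_real (\<integral>x. h x \<partial>\<nu>)) \<le> 3 * e / 16"
      using hp[OF \<mu>, of n] hp[OF \<nu>] elim(1)
        norm_triangle_ineq[of "of_real (\<integral>x. h x \<partial>\<mu> n) - (CLINT x|\<mu> n. p x)" "(CLINT x|\<mu> n. p x) - (CLINT x|\<nu>. p x)"]
        norm_triangle_ineq[of "of_real (\<integral>x. h x \<partial>\<mu> n) - (CLINT x|\<nu>. p x)" "(CLINT x|\<nu>. p x) - of_real (\<integral>x. h x \<partial>\<nu>)"]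
      by (simp add: norm_minus_commute)
    then have "\<bar>(\<integral>x. h x \<partial>\<mu> n) - (\<integral>x. h x \<partial>\<nu>)\<bar> \<le> 3 * e / 16"
      by (metis norm_of_real of_real_diff)
    moreover have "\<bar>(\<integral>x. g x \<partial>\<mu> n) - (\<integral>x. h x \<partial>\<mu> n)\<bar> < e / 8"
      using gh_int[OF \<mu>, of n] b[OF elim(2)] by linarith
    moreover have "\<bar>(\<integral>x. g x \<partial>\<nu>) - (\<integral>x. h x \<partial>\<nu>)\<bar> < e / 8"
      using gh_int[OF \<nu>] b[OF N(1)] by linarith
    ultimately show ?case 
      unfolding real_norm_def using \<open>e > 0\<close> by linarith
  qed
  then show "\<exists>no. \<forall>n\<ge>no. norm ((\<integral>x. g x \<partial>\<mu> n) - (\<integral>x. g x \<partial>\<nu>)) < e"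
    by (simp add: eventually_sequentially)
qed

section \<open>Uniqueness of the law with a given characteristic function\<close>

lemma measurable_reindex:
  assumes "\<And>l. l \<in> I \<Longrightarrow> h l \<in> J"
  shows "(\<lambda>x. \<lambda>l\<in>I. x (h l)) \<in> PiM J (\<lambda>_. borel :: real measure) \<rightarrow>\<^sub>M PiM I (\<lambda>_. borel)"
  by (rule measurable_restrict) (use assms in \<open>auto intro: measurable_component_singleton\<close>)

text \<open>Laws on a finite product with arbitrary index set are moved to an initial segment of the natural
  numbers, where the continuity theorem is available.\<close>
lemma joint_char_reindex:
  assumes J: "finite J" and h: "bij_betw h I J"
    and "sets \<mu> = sets (PiM J (\<lambda>_. borel))"
  shows "joint_char I (distr \<mu> (PiM I (\<lambda>_. borel)) (\<lambda>x. \<lambda>l\<in>I. x (h l))) t =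
    joint_char J \<mu> (\<lambda>i. t (inv_into I h i))"
proof -
  have "(\<lambda>x. \<lambda>l\<in>I. x (h l)) \<in> \<mu> \<rightarrow>\<^sub>M PiM I (\<lambda>_. borel)"
    using measurable_reindex[of I h J] bij_betwE[OF h] by (simp add: measurable_cong_sets[OF assms(3) refl])
  moreover have "(\<Sum>l\<in>I. t l * x (h l)) = (\<Sum>i\<in>J. t (inv_into I h i) * x i)" for x
    using h by (intro sum.reindex_bij_betw[THEN trans[rotated], OF h] sum.cong refl)
      (simp add: bij_betw_inv_into_left)
  ultimately show ?thesis
    unfolding joint_char_def by (subst integral_distr) auto
qed

text \<open>A half-space bounding one coordinate is the countable union of the lower boxes that bound the
  remaining, finitely many coordinates by \<open>n\<close>.\<close>
lemma sets_PiM_lower_boxes: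
  assumes J: "finite J"
  shows "sets (PiM J (\<lambda>_. borel :: real measure)) =
    sigma_sets (PiE J (\<lambda>_. UNIV)) (range (\<lambda>a. PiE J (\<lambda>i. {..a i})))"
    (is "_ = sigma_sets ?\<Omega> ?E")
proof
  have sub: "?E \<subseteq> Pow ?\<Omega>" by auto
  let ?S = "sigma ?\<Omega> ?E"
  have "(\<lambda>x. x) \<in> ?S \<rightarrow>\<^sub>M PiM J (\<lambda>_. borel :: real measure)"
  proof (rule measurable_PiM_single')
    fix i assume i: "i \<in> J"
    have "{x \<in> space ?S. x i \<le> b} \<in> sets ?S" for b
    proof -
      have "{x \<in> space ?S. x i \<le> b} = (\<Union>n::nat. PiE J (\<lambda>j. {..if j = i then b else real n}))"
      proof (rule set_eqI, rule iffI)
        fix x assume "x \<in> {x \<in> space ?S. x i \<le> b}"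
        then have x: "x \<in> ?\<Omega>" "x i \<le> b" using sub by (auto simp: space_measure_of)
        obtain n :: nat where n: "(\<Sum>j\<in>J. \<bar>x j\<bar>) \<le> n" using real_arch_simple by blast
        have "x j \<le> n" if "j \<in> J" for j
          using member_le_sum[of j J "\<lambda>j. \<bar>x j\<bar>"] that J n by simp
        then have "x \<in> PiE J (\<lambda>j. {..if j = i then b else real n})"
          using x by (auto simp: PiE_iff)
        then show "x \<in> (\<Union>n::nat. PiE J (\<lambda>j. {..if j = i then b else real n}))" by blast
      next
        fix x assume "x \<in> (\<Union>n::nat. PiE J (\<lambda>j. {..if j = i then b else real n}))"
        then obtain n :: nat where "x \<in> PiE J (\<lambda>j. {..if j = i then b else real n})" by blast
        then show "x \<in> {x \<in> space ?S. x i \<le> b}"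
          using i by (auto simp: PiE_iff space_measure_of[OF sub])
      qed
      moreover have "PiE J (\<lambda>j. {..if j = i then b else real n}) \<in> sets ?S" for n
        unfolding sets_measure_of[OF sub] by (intro sigma_sets.Basic) auto
      ultimately show ?thesis by auto
    qed
    then show "(\<lambda>x. x i) \<in> borel_measurable ?S" by (simp add: borel_measurable_iff_le)
  qed (simp add: space_measure_of[OF sub])
  then have "A \<inter> ?\<Omega> \<in> sets ?S" if "A \<in> sets (PiM J (\<lambda>_. borel :: real measure))" for A
    using measurable_sets[OF _ that, of "\<lambda>x. x" ?S] by (simp add: space_measure_of[OF sub])
  then show "sets (PiM J (\<lambda>_. borel :: real measure)) \<subseteq> sigma_sets ?\<Omega> ?E"
    using sets.sets_into_space[of _ "PiM J (\<lambda>_. borel :: real measure)"]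
    by (fastforce simp: space_PiM sets_measure_of[OF sub] Int_absorb2)
  show "sigma_sets ?\<Omega> ?E \<subseteq> sets (PiM J (\<lambda>_. borel :: real measure))"
    by (rule sigma_algebra.sigma_sets_subset[OF sets.sigma_algebra_axioms, of _ "PiM J (\<lambda>_. borel)", unfolded space_PiM space_borel])
      (use J in \<open>auto intro!: sets_PiM_I_finite\<close>)
qed

lemma lower_box_ramp_tendsto:
  fixes a y :: real
  shows "(\<lambda>N. max 0 (min 1 (1 + real N * (a - y)))) \<longlonglongrightarrow> indicator {..a} y"
proof (cases "y \<le> a")
  case True
  then show ?thesis by (simp add: min_absorb1)
next
  case False
  obtain N0 :: nat where N0: "1 / (y - a) < N0" using reals_Archimedean2 by blast
  have "max 0 (min 1 (1 + real N * (a - y))) = 0" if "N \<ge> N0" for N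
  proof -
    have "1 / (y - a) < real N" using N0 that by linarith
    then have "1 < real N * (y - a)" using False by (simp add: field_simps)
    then show ?thesis by (simp add: algebra_simps max_def min_def)
  qed
  then show ?thesis
    using False by (intro tendsto_eventually eventually_sequentiallyI[of N0]) simp
qed

text \<open>For a constant sequence the continuity theorem says that the two laws give the same integral to
  every bounded continuous function. The indicator of a lower box is a bounded limit of such
  functions, and the lower boxes are an intersection-stable generator.\<close>
theorem joint_char_determines_measure:
  assumes J: "finite J"
    and \<mu>: "prob_space \<mu>" "sets \<mu> = sets (PiM J (\<lambda>_. borel))"
    and \<nu>: "prob_space \<nu>" "sets \<nu> = sets (PiM J (\<lambda>_. borel))"
    and eq: "\<And>t. joint_char J \<mu> t = joint_char J \<nu> t"
  shows "\<mu> = \<nu>"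
proof (rule measure_eqI_generator_eq)
  let ?\<Omega> = "PiE J (\<lambda>_. UNIV :: real set)"
  let ?E = "range (\<lambda>a. PiE J (\<lambda>i. {..a i :: real}))"
  define I where "I = {0..<card J}"
  obtain h where h: "bij_betw h I J"
    using ex_bij_betw_nat_finite[OF J] unfolding I_def by blast
  have I: "finite I" by (simp add: I_def)
  define R where "R x = (\<lambda>l\<in>I. x (h l) :: real)" for x
  have R_meas: "R \<in> \<rho> \<rightarrow>\<^sub>M PiM I (\<lambda>_. borel)" if "sets \<rho> = sets (PiM J (\<lambda>_. borel))" for \<rho> :: "('a \<Rightarrow> real) measure"
    using measurable_reindex[of I h J] bij_betwE[OF h] unfolding R_def
    by (simp add: measurable_cong_sets[OF that refl])
  have push: "(\<integral>x. g (R x) \<partial>\<mu>) = (\<integral>x. g (R x) \<partial>\<nu>)"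
    if g: "continuous_on (PiE I (\<lambda>_. UNIV)) g" "bounded (g ` PiE I (\<lambda>_. UNIV))" for g :: "_ \<Rightarrow> real"
  proof -
    let ?m = "distr \<mu> (PiM I (\<lambda>_. borel)) R" and ?n = "distr \<nu> (PiM I (\<lambda>_. borel)) R"
    have "(\<lambda>_::nat. \<integral>y. g y \<partial>?m) \<longlonglongrightarrow> (\<integral>y. g y \<partial>?n)"
    proof (rule multivariate_levy_continuity[OF I])
      show "prob_space ?m" "prob_space ?n"
        using prob_space.prob_space_distr[OF \<mu>(1) R_meas[OF \<mu>(2)]]
          prob_space.prob_space_distr[OF \<nu>(1) R_meas[OF \<nu>(2)]] by auto
      show "(\<lambda>_::nat. joint_char I ?m t) \<longlonglongrightarrow> joint_char I ?n t" for t
        using joint_char_reindex[OF J h \<mu>(2), of t] joint_char_reindex[OF J h \<nu>(2), of t] eq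
        unfolding R_def by simp
    qed (use g in auto)
    then have "(\<integral>y. g y \<partial>?m) = (\<integral>y. g y \<partial>?n)" by (rule LIMSEQ_const_iff[THEN iffD1])
    moreover have "g \<in> borel_measurable (PiM I (\<lambda>_. borel))"
      by (rule continuous_on_PiE_measurable[OF I g(1)])
    ultimately show ?thesis
      using integral_distr[OF R_meas[OF \<mu>(2)], of g] integral_distr[OF R_meas[OF \<nu>(2)], of g] by simp
  qed
  show "emeasure \<mu> X = emeasure \<nu> X" if X: "X \<in> ?E" for X
  proof -
    obtain a where a: "X = PiE J (\<lambda>i. {..a i})" using X by auto
    define q where "q N y = (\<Prod>l\<in>I. max 0 (min 1 (1 + real N * (a (h l) - y l))))" for N :: nat and y :: "nat \<Rightarrow> real"
    have q_bd: "0 \<le> q N y" "q N y \<le> 1" for N y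
      unfolding q_def by (auto intro!: prod_nonneg prod_le_1)
    have q_cont: "continuous_on S (q N)" for S N
      unfolding q_def
      by (intro continuous_on_prod continuous_on_max continuous_on_min continuous_on_const
          continuous_on_add continuous_on_mult continuous_on_diff
          continuous_on_subset[OF continuous_on_product_coordinates]) auto
    have q_lim: "(\<lambda>N. q N (R x)) \<longlonglongrightarrow> indicator X x" if x: "x \<in> ?\<Omega>" for x
    proof -
      have "(\<lambda>N. q N (R x)) \<longlonglongrightarrow> (\<Prod>l\<in>I. indicator {..a (h l)} (R x l))"
        unfolding q_def by (intro tendsto_prod lower_box_ramp_tendsto)
      also have "(\<Prod>l\<in>I. indicator {..a (h l)} (R x l)) = (\<Prod>l\<in>I. (indicator {..a (h l)} (x (h l)) :: real))"
        by (intro prod.cong) (auto simp: R_def)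
      also have "\<dots> = (\<Prod>i\<in>J. indicator {..a i} (x i))"
        by (rule prod.reindex_bij_betw[OF h])
      also have "\<dots> = indicator X x"
        using J x by (auto simp: a indicator_def PiE_iff prod_zero_iff)
      finally show ?thesis .
    qed
    have lim: "(\<lambda>N. \<integral>x. q N (R x) \<partial>\<rho>) \<longlonglongrightarrow> measure \<rho> X"
      if \<rho>: "prob_space \<rho>" "sets \<rho> = sets (PiM J (\<lambda>_. borel))" for \<rho>
    proof -
      interpret prob_space \<rho> by fact
      have sp: "space \<rho> = ?\<Omega>" using sets_eq_imp_space_eq[OF \<rho>(2)] by (simp add: space_PiM)
      have X_sets: "X \<in> sets \<rho>" unfolding \<rho>(2) a using J by (intro sets_PiM_I_finite) auto
      have "(\<lambda>N. \<integral>x. q N (R x) \<partial>\<rho>) \<longlonglongrightarrow> (\<integral>x. indicator X x \<partial>\<rho>)"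
      proof (rule integral_dominated_convergence[where w = "\<lambda>_. 1"])
        show "(\<lambda>x. q N (R x)) \<in> borel_measurable \<rho>" for N
          using measurable_comp[OF R_meas[OF \<rho>(2)] continuous_on_PiE_measurable[OF I q_cont, of N]]
          by (simp add: comp_def)
        show "AE x in \<rho>. (\<lambda>N. q N (R x)) \<longlonglongrightarrow> indicator X x"
          by (rule AE_I2) (simp add: sp q_lim)
        show "AE x in \<rho>. norm (q N (R x)) \<le> 1" for N
          using q_bd by (simp add: abs_of_nonneg)
      qed (use X_sets in auto)
      then show ?thesis using X_sets by simp
    qed
    have "(\<integral>x. q N (R x) \<partial>\<mu>) = (\<integral>x. q N (R x) \<partial>\<nu>)" for N
    proof (rule push[OF q_cont])
      show "bounded (q N ` PiE I (\<lambda>_. UNIV))"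
        using q_bd by (intro boundedI[of _ 1]) (auto simp: abs_of_nonneg)
    qed
    then have "measure \<mu> X = measure \<nu> X"
      using LIMSEQ_unique[OF lim[OF \<mu>]] lim[OF \<nu>] by simp
    moreover have "finite_measure \<mu>" "finite_measure \<nu>"
      using \<mu>(1) \<nu>(1) by (simp_all add: prob_space.finite_measure)
    ultimately show ?thesis by (simp add: finite_measure.emeasure_eq_measure)
  qed
  show "Int_stable ?E"
  proof (rule Int_stableI)
    fix A B assume "A \<in> ?E" "B \<in> ?E"
    then obtain a b where ab: "A = PiE J (\<lambda>i. {..a i})" "B = PiE J (\<lambda>i. {..b i})" by auto
    have "A \<inter> B = PiE J (\<lambda>i. {..min (a i) (b i)})"
      unfolding ab PiE_Int by (intro PiE_cong) auto
    then show "A \<inter> B \<in> ?E" by auto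
  qed
  show "?E \<subseteq> Pow ?\<Omega>" by auto
  show "sets \<mu> = sigma_sets ?\<Omega> ?E" "sets \<nu> = sigma_sets ?\<Omega> ?E"
    using \<mu>(2) \<nu>(2) sets_PiM_lower_boxes[OF J] by auto
  show "range (\<lambda>n. PiE J (\<lambda>_. {..real n})) \<subseteq> ?E" by auto
  show "(\<Union>n. PiE J (\<lambda>_. {..real n})) = ?\<Omega>"
  proof (rule antisym)
    show "?\<Omega> \<subseteq> (\<Union>n. PiE J (\<lambda>_. {..real n}))"
    proof
      fix x assume x: "x \<in> ?\<Omega>"
      obtain n :: nat where n: "(\<Sum>j\<in>J. \<bar>x j\<bar>) \<le> n" using real_arch_simple by blast
      have "x j \<le> n" if "j \<in> J" for j
        using member_le_sum[of j J "\<lambda>j. \<bar>x j\<bar>"] that J n by simp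
      then have "x \<in> PiE J (\<lambda>_. {..real n})" using x by (auto simp: PiE_iff)
      then show "x \<in> (\<Union>n. PiE J (\<lambda>_. {..real n}))" by blast
    qed
  qed auto
  show "emeasure \<mu> (PiE J (\<lambda>_. {..real n})) \<noteq> \<infinity>" for n
    using finite_measure.emeasure_finite[OF prob_space.finite_measure[OF \<mu>(1)]] by simp
qed

section \<open>Gaussian laws with a given covariance\<close>

definition quad_form :: "'i set \<Rightarrow> ('i \<Rightarrow> 'i \<Rightarrow> real) \<Rightarrow> ('i \<Rightarrow> real) \<Rightarrow> real" where
  "quad_form J c t = (\<Sum>i\<in>J. \<Sum>j\<in>J. t i * t j * c i j)"

definition psd_on :: "'i set \<Rightarrow> ('i \<Rightarrow> 'i \<Rightarrow> real) \<Rightarrow> bool" where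
  "psd_on I c \<longleftrightarrow> (\<forall>i\<in>I. \<forall>j\<in>I. c i j = c j i) \<and>
     (\<forall>J t. finite J \<longrightarrow> J \<subseteq> I \<longrightarrow> 0 \<le> quad_form J c t)"

lemma psd_on_subset: "psd_on I c \<Longrightarrow> J \<subseteq> I \<Longrightarrow> psd_on J c"
  unfolding psd_on_def by blast

lemma quad_form_cong: "(\<And>i. i \<in> J \<Longrightarrow> s i = t i) \<Longrightarrow> quad_form J c s = quad_form J c t"
  unfolding quad_form_def by (intro sum.cong refl) auto

lemma quad_form_insert:
  assumes "finite J" "x \<notin> J" "\<And>j. j \<in> J \<Longrightarrow> c j x = c x j"
  shows "quad_form (insert x J) c t =
    (t x)\<^sup>2 * c x x + 2 * t x * (\<Sum>j\<in>J. t j * c x j) + quad_form J c t"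
proof -
  have "(\<Sum>i\<in>J. t i * t x * c i x) = t x * (\<Sum>j\<in>J. t j * c x j)"
    unfolding sum_distrib_left by (intro sum.cong refl) (simp add: assms(3))
  then show ?thesis
    using assms(1,2)
    by (simp add: quad_form_def sum.distrib power2_eq_square sum_distrib_left mult.assoc)
qed

text \<open>Passing to a marginal of a Gaussian law means setting the remaining arguments of its
  characteristic function to 0.\<close>
lemma quad_form_extend_zero:
  assumes "finite H" "J \<subseteq> H"
  shows "quad_form H c (\<lambda>i. if i \<in> J then t i else 0) = quad_form J c t"
proof -
  have "quad_form H c (\<lambda>i. if i \<in> J then t i else 0) =
      (\<Sum>i\<in>J. \<Sum>j\<in>H. t i * (if j \<in> J then t j else 0) * c i j)"
    unfolding quad_form_def using assms by (intro sum.mono_neutral_cong_right) auto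
  also have "\<dots> = quad_form J c t"
    unfolding quad_form_def using assms
    by (intro sum.cong refl sum.mono_neutral_cong_right) auto
  finally show ?thesis .
qed

text \<open>Induction by Schur complements. If \<open>c x x > 0\<close>, the part of \<open>c\<close> that \<open>x\<close> explains is split off: the
  form \<open>c i j - c x i * c x j / c x x\<close> is the minimum of the full form over the argument at \<open>x\<close>, hence
  positive semidefinite, and the new index serves as an additional direction. If \<open>c x x = 0\<close>, the
  whole row of \<open>x\<close> vanishes and \<open>x\<close> is represented by the zero vector.\<close>
lemma psd_gram:
  assumes "finite J" "psd_on J c"
  shows "\<exists>w. \<forall>i\<in>J. \<forall>j\<in>J. c i j = (\<Sum>l\<in>J. w i l * w j l)"
  using assms
proof (induction J arbitrary: c rule: finite_induct)
  case empty
  then show ?case by simp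
next
  case (insert x J)
  have sym: "c i j = c j i" if "i \<in> insert x J" "j \<in> insert x J" for i j
    using insert.prems that unfolding psd_on_def by blast
  have pos: "0 \<le> (t x)\<^sup>2 * c x x + 2 * t x * (\<Sum>j\<in>J. t j * c x j) + quad_form J c t" for t
  proof -
    have "0 \<le> quad_form (insert x J) c t"
      using insert.prems insert.hyps unfolding psd_on_def by blast
    then show ?thesis by (subst (asm) quad_form_insert) (use insert.hyps sym in auto)
  qed
  have cxx: "0 \<le> c x x"
  proof -
    define t where "t i = (if i = x then 1 else 0 :: real)" for i
    have t: "t i = 0" if "i \<in> J" for i using that insert.hyps by (auto simp: t_def)
    have "quad_form J c t = 0" unfolding quad_form_def by (simp add: t)
    moreover have "(\<Sum>j\<in>J. t j * c x j) = 0" by (simp add: t)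
    ultimately show ?thesis using pos[of t] by (simp add: t_def)
  qed
  show ?case
  proof (cases "c x x = 0")
    case True
    have cxj: "c x k = 0" if k: "k \<in> J" for k
    proof (rule ccontr)
      assume nz: "c x k \<noteq> 0"
      \<comment> \<open>with no quadratic term in s, the form is affine in s and takes the value -1 for this choice\<close>
      define s where "s = - (c k k + 1) / (2 * c x k)"
      define t where "t i = (if i = x then s else if i = k then 1 else 0)" for i
      have "(\<Sum>j\<in>J. t j * c x j) = (\<Sum>j\<in>J. if j = k then c x j else 0)"
        using insert.hyps by (intro sum.cong) (auto simp: t_def)
      also have "\<dots> = c x k" using k insert.hyps by simp
      finally have 1: "(\<Sum>j\<in>J. t j * c x j) = c x k" .
      have "quad_form J c t = (\<Sum>i\<in>J. \<Sum>j\<in>J. if j = k then (if i = k then c i j else 0) else 0)"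
        unfolding quad_form_def using insert.hyps by (intro sum.cong) (auto simp: t_def)
      also have "\<dots> = c k k" using k insert.hyps by simp
      finally have 2: "quad_form J c t = c k k" .
      have "0 \<le> 2 * s * c x k + c k k"
        using pos[of t] True unfolding 1 2 by (simp add: t_def)
      also have "2 * s * c x k = - (c k k + 1)" using nz by (simp add: s_def)
      finally show False by simp
    qed
    have "psd_on J c" using psd_on_subset[OF insert.prems] by blast
    then obtain w where w: "\<And>i j. i \<in> J \<Longrightarrow> j \<in> J \<Longrightarrow> c i j = (\<Sum>l\<in>J. w i l * w j l)"
      using insert.IH by blast
    define w' where "w' i l = (if i = x \<or> l = x then 0 else w i l)" for i l
    have "c i j = (\<Sum>l\<in>insert x J. w' i l * w' j l)" if ij: "i \<in> insert x J" "j \<in> insert x J" for i j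
    proof (cases "i = x \<or> j = x")
      case True
      then have "c i j = 0" using cxj sym[OF ij] ij \<open>c x x = 0\<close> by auto
      moreover have "(\<Sum>l\<in>insert x J. w' i l * w' j l) = 0"
        using True by (intro sum.neutral ballI) (auto simp: w'_def)
      ultimately show ?thesis by simp
    next
      case False
      then have "(\<Sum>l\<in>insert x J. w' i l * w' j l) = (\<Sum>l\<in>J. w i l * w j l)"
        using insert.hyps by (auto simp: w'_def intro!: sum.cong)
      then show ?thesis using w False ij by auto
    qed
    then show ?thesis by blast
  next
    case False
    then have cpos: "c x x > 0" using cxx by simp
    define d where "d i j = c i j - c x i * c x j / c x x" for i j
    have d_q: "quad_form J d t = quad_form J c t - (\<Sum>j\<in>J. t j * c x j)\<^sup>2 / c x x" for t
    proof -
      have "(\<Sum>j\<in>J. t j * c x j)\<^sup>2 / c x x = (\<Sum>i\<in>J. \<Sum>j\<in>J. t i * t j * (c x i * c x j / c x x))"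
        unfolding power2_eq_square sum_product sum_divide_distrib
        by (intro sum.cong refl) simp
      then show ?thesis
        unfolding quad_form_def d_def by (simp add: right_diff_distrib sum_subtractf)
    qed
    have "psd_on J d"
      unfolding psd_on_def
    proof (intro conjI ballI allI impI)
      fix i j assume "i \<in> J" "j \<in> J"
      then show "d i j = d j i" using sym[of i j] by (simp add: d_def)
    next
      fix K and t :: "'a \<Rightarrow> real" assume K: "finite K" "K \<subseteq> J"
      define u where "u i = (if i \<in> K then t i else 0)" for i
      define B where "B = (\<Sum>j\<in>J. u j * c x j)"
      \<comment> \<open>the value at x that minimises the form, given the values u on J\<close>
      define v where "v i = (if i = x then - B / c x x else u i)" for i
      have vJ: "v j = u j" if "j \<in> J" for j using that insert.hyps by (auto simp: v_def)
      have "(\<Sum>j\<in>J. v j * c x j) = B"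
        unfolding B_def using vJ by simp
      then have "0 \<le> (B / c x x)\<^sup>2 * c x x - 2 * (B / c x x) * B + quad_form J c v"
        using pos[of v] by (simp add: v_def)
      also have "quad_form J c v = quad_form J c u"
        using vJ by (rule quad_form_cong)
      also have "(B / c x x)\<^sup>2 * c x x - 2 * (B / c x x) * B + quad_form J c u = quad_form J d u"
        unfolding d_q B_def[symmetric] using cpos by (simp add: power2_eq_square)
      also have "\<dots> = quad_form K d t"
        unfolding u_def by (rule quad_form_extend_zero[OF insert.hyps(1) K(2)])
      finally show "0 \<le> quad_form K d t" .
    qed
    then obtain w where w: "\<And>i j. i \<in> J \<Longrightarrow> j \<in> J \<Longrightarrow> d i j = (\<Sum>l\<in>J. w i l * w j l)"
      using insert.IH by blast
    define w' where "w' i l = (if l = x then c x i / sqrt (c x x) else if i = x then 0 else w i l)" for i l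
    have "c i j = (\<Sum>l\<in>insert x J. w' i l * w' j l)" if ij: "i \<in> insert x J" "j \<in> insert x J" for i j
    proof -
      have "(\<Sum>l\<in>insert x J. w' i l * w' j l) = w' i x * w' j x + (\<Sum>l\<in>J. w' i l * w' j l)"
        using insert.hyps by simp
      also have "w' i x * w' j x = c x i * c x j / c x x"
        using cpos by (simp add: w'_def)
      also have "(\<Sum>l\<in>J. w' i l * w' j l) = (if i = x \<or> j = x then 0 else (\<Sum>l\<in>J. w i l * w j l))"
        using insert.hyps by (auto simp: w'_def intro!: sum.cong sum.neutral)
      also have "c x i * c x j / c x x + \<dots> = c i j"
        using w[of i j] ij sym[of i x] sym[of j x] cpos by (auto simp: d_def)
      finally show ?thesis by simp
    qed
    then show ?thesis by blast
  qed
qed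

text \<open>Describing the law by its characteristic function rather than by a density covers singular \<open>c\<close>.\<close>
definition is_gaussian_law :: "'i set \<Rightarrow> ('i \<Rightarrow> 'i \<Rightarrow> real) \<Rightarrow> ('i \<Rightarrow> real) measure \<Rightarrow> bool" where
  "is_gaussian_law J c P \<longleftrightarrow> prob_space P \<and> sets P = sets (PiM J (\<lambda>_. borel)) \<and>
     (\<forall>t. joint_char J P t = of_real (exp (- quad_form J c t / 2)))"

text \<open>The Gram vectors \<open>w\<close> of \<open>c\<close> turn independent standard normal variables into a Gaussian vector:
  the linear form \<open>\<Sum> t i * X i\<close> has coefficients \<open>u l\<close> in these variables, and \<open>\<Sum> (u l)\<^sup>2\<close> is the
  quadratic form of \<open>c\<close>.\<close>
lemma gaussian_law_exists:
  fixes J :: "'i set"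
  assumes J: "finite J" and c: "psd_on J c"
  shows "\<exists>P. is_gaussian_law J c P"
proof -
  obtain w where w: "\<And>i j. i \<in> J \<Longrightarrow> j \<in> J \<Longrightarrow> c i j = (\<Sum>l\<in>J. w i l * w j l)"
    using psd_gram[OF assms] by blast
  interpret S: real_distribution std_normal_distribution by (rule real_dist_normal_dist)
  interpret product_prob_space "\<lambda>_::'i. std_normal_distribution" J
    by unfold_locales
  let ?N = "PiM J (\<lambda>_. std_normal_distribution)"
  have sets_N: "sets ?N = sets (PiM J (\<lambda>_. borel))" by (rule sets_PiM_cong) auto
  define T where "T z = (\<lambda>i\<in>J. \<Sum>l\<in>J. w i l * z l)" for z :: "'i \<Rightarrow> real"
  have T: "T \<in> ?N \<rightarrow>\<^sub>M PiM J (\<lambda>_. borel)"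
    unfolding T_def measurable_cong_sets[OF sets_N refl] by measurable
  have "joint_char J (distr ?N (PiM J (\<lambda>_. borel)) T) t = of_real (exp (- quad_form J c t / 2))" for t
  proof -
    define u where "u l = (\<Sum>i\<in>J. t i * w i l)" for l
    have lin: "(\<Sum>i\<in>J. t i * T z i) = (\<Sum>l\<in>J. u l * z l)" for z
    proof -
      have "(\<Sum>i\<in>J. t i * T z i) = (\<Sum>i\<in>J. \<Sum>l\<in>J. t i * w i l * z l)"
        by (intro sum.cong refl) (simp add: T_def sum_distrib_left mult.assoc)
      also have "\<dots> = (\<Sum>l\<in>J. \<Sum>i\<in>J. t i * w i l * z l)" by (rule sum.swap)
      finally show ?thesis by (simp add: u_def sum_distrib_right)
    qed
    have quad: "quad_form J c t = (\<Sum>l\<in>J. (u l)\<^sup>2)"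
    proof -
      have "quad_form J c t = (\<Sum>i\<in>J. \<Sum>j\<in>J. \<Sum>l\<in>J. t i * w i l * (t j * w j l))"
        unfolding quad_form_def
        by (intro sum.cong refl) (simp add: w sum_distrib_left mult_ac)
      also have "\<dots> = (\<Sum>i\<in>J. \<Sum>l\<in>J. \<Sum>j\<in>J. t i * w i l * (t j * w j l))"
        by (intro sum.cong refl sum.swap)
      also have "\<dots> = (\<Sum>l\<in>J. \<Sum>i\<in>J. \<Sum>j\<in>J. t i * w i l * (t j * w j l))"
        by (rule sum.swap)
      finally show ?thesis by (simp add: u_def power2_eq_square sum_product)
    qed
    have "joint_char J (distr ?N (PiM J (\<lambda>_. borel)) T) t = (CLINT z|?N. iexp (\<Sum>i\<in>J. t i * T z i))"
      unfolding joint_char_def by (rule integral_distr[OF T]) measurable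
    also have "\<dots> = (CLINT z|?N. (\<Prod>l\<in>J. iexp (u l * z l)))"
      unfolding lin using J by (simp add: exp_sum sum_distrib_left)
    also have "\<dots> = (\<Prod>l\<in>J. CLINT z|std_normal_distribution. iexp (u l * z))"
      by (rule product_integral_prod[OF J]) (intro S.integrable_iexp, auto)
    also have "\<dots> = (\<Prod>l\<in>J. char std_normal_distribution (u l))"
      by (simp add: char_def)
    also have "\<dots> = of_real (\<Prod>l\<in>J. exp (- (u l)\<^sup>2 / 2))"
      by (simp add: char_std_normal_distribution)
    also have "(\<Prod>l\<in>J. exp (- (u l)\<^sup>2 / 2)) = exp (- quad_form J c t / 2)"
      unfolding quad using J by (simp add: exp_sum[symmetric] sum_negf sum_divide_distrib[symmetric])
    finally show ?thesis .
  qed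
  moreover have "prob_space (distr ?N (PiM J (\<lambda>_. borel)) T)"
    by (rule prob_space.prob_space_distr[OF _ T]) unfold_locales
  ultimately show ?thesis unfolding is_gaussian_law_def by (intro exI[of _ "distr ?N (PiM J (\<lambda>_. borel)) T"]) auto
qed

lemma joint_char_restrict:
  assumes "finite H" "J \<subseteq> H" and sets: "sets \<mu> = sets (PiM I (\<lambda>_. borel))" "H \<subseteq> I"
  shows "joint_char J (distr \<mu> (PiM J (\<lambda>_. borel)) (\<lambda>x. restrict x J)) t =
    joint_char H \<mu> (\<lambda>i. if i \<in> J then t i else 0)"
proof -
  have "(\<lambda>x. restrict x J) \<in> \<mu> \<rightarrow>\<^sub>M PiM J (\<lambda>_. borel)"
    unfolding measurable_cong_sets[OF sets(1) refl]
    using assms(2,4) by (intro measurable_restrict_subset) auto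
  moreover have "(\<Sum>i\<in>H. (if i \<in> J then t i else 0) * x i) = (\<Sum>i\<in>J. t i * restrict x J i)" for x
    using assms(1,2) by (intro sum.mono_neutral_cong_right) auto
  ultimately show ?thesis
    unfolding joint_char_def by (subst integral_distr) auto
qed

text \<open>Kolmogorov's extension theorem. The finite-dimensional laws are consistent because both sides
  have the same characteristic function.\<close>
theorem gaussian_field_exists:
  fixes I :: "'i set"
  assumes c: "psd_on I c"
  shows "\<exists>N. prob_space N \<and> sets N = sets (PiM I (\<lambda>_. borel)) \<and>
    (\<forall>J t. finite J \<longrightarrow> J \<subseteq> I \<longrightarrow> joint_char J N t = of_real (exp (- quad_form J c t / 2)))"
proof -
  define P where "P J = (SOME P. is_gaussian_law J c P)" for J :: "'i set"
  have P: "is_gaussian_law J c (P J)" if "finite J" "J \<subseteq> I" for J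
    unfolding P_def using gaussian_law_exists[OF that(1) psd_on_subset[OF c that(2)]] by (rule someI_ex)
  note P_prob = P[unfolded is_gaussian_law_def, THEN conjunct1]
  note P_sets = P[unfolded is_gaussian_law_def, THEN conjunct2, THEN conjunct1]
  have P_char: "joint_char J (P J) t = of_real (exp (- quad_form J c t / 2))"
    if "finite J" "J \<subseteq> I" for J t
    using P[OF that] unfolding is_gaussian_law_def by blast
  interpret polish_projective I P
  proof (intro polish_projective.intro projective_family.intro)
    fix J assume J: "finite J" "J \<subseteq> I"
    then show "prob_space (P J)" by (rule P_prob)
  next
    fix J H assume JH: "J \<subseteq> H" "finite H" "H \<subseteq> I"
    then have J: "finite J" "J \<subseteq> I" by (auto intro: finite_subset)
    let ?Q = "distr (P H) (PiM J (\<lambda>_. borel)) (\<lambda>f. restrict f J)"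
    have "(\<lambda>x. restrict x J) \<in> P H \<rightarrow>\<^sub>M PiM J (\<lambda>_. borel)"
      unfolding measurable_cong_sets[OF P_sets[OF JH(2,3)] refl]
      using JH(1) by (intro measurable_restrict_subset) auto
    then have "prob_space ?Q" by (rule prob_space.prob_space_distr[OF P_prob[OF JH(2,3)]])
    moreover have "joint_char J (P J) t = joint_char J ?Q t" for t
      by (simp add: joint_char_restrict[OF JH(2,1) P_sets[OF JH(2,3)]] P_char J JH quad_form_extend_zero)
    ultimately show "P J = ?Q"
      by (intro joint_char_determines_measure[OF J(1) P_prob[OF J] P_sets[OF J]]) auto
  qed
  have "joint_char J lim t = of_real (exp (- quad_form J c t / 2))" if J: "finite J" "J \<subseteq> I" for J t
  proof -
    have meas: "(\<lambda>x. restrict x J) \<in> lim \<rightarrow>\<^sub>M PiM J (\<lambda>_. borel)"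
      unfolding measurable_cong_sets[OF sets_lim refl]
      using J(2) by (intro measurable_restrict_subset) auto
    have "distr lim (PiM J (\<lambda>_. borel)) (\<lambda>x. restrict x J) = P J"
    proof (rule measure_eqI)
      fix A assume "A \<in> sets (distr lim (PiM J (\<lambda>_. borel)) (\<lambda>x. restrict x J))"
      then have A: "A \<in> sets (PiM J (\<lambda>_. borel))" by simp
      have "emeasure (distr lim (PiM J (\<lambda>_. borel)) (\<lambda>x. restrict x J)) A = emeasure lim (emb I J A)"
        using meas A by (simp add: emeasure_distr prod_emb_def space_PiM)
      also have "\<dots> = emeasure (P J) A" by (rule emeasure_lim_emb[OF J(2,1) A])
      finally show "emeasure (distr lim (PiM J (\<lambda>_. borel)) (\<lambda>x. restrict x J)) A = emeasure (P J) A" .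
    qed (simp add: P_sets[OF J])
    moreover have "joint_char J (distr lim (PiM J (\<lambda>_. borel)) (\<lambda>x. restrict x J)) t =
        joint_char J lim (\<lambda>i. if i \<in> J then t i else 0)"
      by (rule joint_char_restrict[OF J(1) order_refl sets_lim J(2)])
    moreover have "joint_char J lim (\<lambda>i. if i \<in> J then t i else 0) = joint_char J lim t"
      unfolding joint_char_def by (intro Bochner_Integration.integral_cong refl arg_cong[of _ _ exp] arg_cong[of _ _ "(*) \<i>"]
          arg_cong[of _ _ complex_of_real] sum.cong) auto
    ultimately show ?thesis using P_char[OF J, of t] by simp
  qed
  then show ?thesis using P.prob_space_axioms sets_lim by blast
qed

text \<open>By uniqueness on the line, \<open>U\<close> is distributed as \<open>sqrt q\<close> times a standard normal variable, from
  which the moments are read off; \<open>q = 0\<close> gives the point mass.\<close>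
lemma centered_normal_of_char:
  assumes N: "prob_space N" and U[measurable]: "U \<in> borel_measurable N" and q: "q \<ge> 0"
    and char: "\<And>s. (CLINT x|N. iexp (s * U x)) = of_real (exp (- (s\<^sup>2 * q) / 2))"
  shows "normal_rv N U" "(\<integral>x. U x \<partial>N) = 0" "integrable N (\<lambda>x. (U x)\<^sup>2)" "(\<integral>x. (U x)\<^sup>2 \<partial>N) = q"
proof -
  interpret N: prob_space N by fact
  interpret S: real_distribution std_normal_distribution by (rule real_dist_normal_dist)
  let ?S = "std_normal_distribution"
  have law: "distr N borel U = distr ?S borel (\<lambda>z. sqrt q * z)"
  proof (rule Levy_uniqueness)
    show "real_distribution (distr N borel U)" by (rule N.real_distribution_distr) fact
    show "real_distribution (distr ?S borel (\<lambda>z. sqrt q * z))"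
      by (rule S.real_distribution_distr) simp
    show "char (distr N borel U) = char (distr ?S borel (\<lambda>z. sqrt q * z))"
    proof
      fix s
      have "char (distr ?S borel (\<lambda>z. sqrt q * z)) s = char ?S (s * sqrt q)"
        unfolding char_def by (subst integral_distr) (auto simp: mult.assoc)
      also have "\<dots> = of_real (exp (- (s\<^sup>2 * q) / 2))"
        using q by (simp add: char_std_normal_distribution power_mult_distrib)
      also have "\<dots> = char (distr N borel U) s"
        unfolding char_def using char[of s] by (subst integral_distr) auto
      finally show "char (distr N borel U) s = char (distr ?S borel (\<lambda>z. sqrt q * z)) s" by simp
    qed
  qed
  have transfer: "(\<integral>x. g (U x) \<partial>N) = (\<integral>z. g (sqrt q * z) \<partial>?S)" if "g \<in> borel_measurable borel" for g :: "real \<Rightarrow> real"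
    using arg_cong[OF law, of "\<lambda>D. \<integral>x. g x \<partial>D"] that by (simp add: integral_distr)
  have m1: "(\<integral>z. z \<partial>?S) = 0" using integral_std_normal_distribution_moment_odd[of 1] by simp
  have m2: "(\<integral>z. z\<^sup>2 \<partial>?S) = 1" "integrable ?S (\<lambda>z. z\<^sup>2)"
    using std_normal_distribution_even_moments[of 1] by (simp_all add: fact_numeral)
  show "(\<integral>x. U x \<partial>N) = 0" using transfer[of "\<lambda>x. x"] m1 by simp
  show "(\<integral>x. (U x)\<^sup>2 \<partial>N) = q" using transfer[of "\<lambda>x. x\<^sup>2"] m2 q by (simp add: power_mult_distrib)
  have "integrable (distr ?S borel (\<lambda>z. sqrt q * z)) (\<lambda>x. x\<^sup>2)"
    using m2(2) by (simp add: integrable_distr_eq power_mult_distrib)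
  then show "integrable N (\<lambda>x. (U x)\<^sup>2)"
    unfolding law[symmetric] by (simp add: integrable_distr_eq)
  have "distr N borel U = (if sqrt q = 0 then return borel 0 else density lborel (normal_density 0 (sqrt q)))"
  proof (cases "q = 0")
    case True
    have "distr ?S borel (\<lambda>z. 0) = return borel 0"
      by (rule S.distr_const) simp
    then show ?thesis using law True by simp
  next
    case False
    then have "q > 0" using q by simp
    have "distributed ?S lborel (\<lambda>z. z) std_normal_density"
      by (auto simp: distributed_def intro!: distr_id2)
    from S.normal_density_affine[OF this, of "sqrt q" 0] \<open>q > 0\<close>
    have "distributed ?S lborel (\<lambda>z. sqrt q * z) (normal_density 0 (sqrt q))" by simp
    then have "distr ?S lborel (\<lambda>z. sqrt q * z) = density lborel (normal_density 0 (sqrt q))"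
      by (rule distributed_distr_eq_density)
    moreover have "distr ?S lborel (\<lambda>z. sqrt q * z) = distr ?S borel (\<lambda>z. sqrt q * z)"
      by (rule distr_cong) auto
    ultimately show ?thesis using law False by simp
  qed
  moreover have "sqrt q \<ge> 0" using q by simp
  ultimately show "normal_rv N U" unfolding normal_rv_def using U by blast
qed

text \<open>The filter has a countable base, so a sequence of points violating convergence can be chosen along
  it. This reduces the two-parameter limit to sequences, for which Levy's theorem is stated.\<close>
section \<open>Limits in two parameters\<close>

lemma tendsto_both_infI:
  assumes "\<And>\<sigma> :: nat \<Rightarrow> nat \<times> nat. filterlim \<sigma> both_inf sequentially \<Longrightarrow> (\<lambda>n. f (\<sigma> n)) \<longlonglongrightarrow> l"
  shows "(f \<longlongrightarrow> l) both_inf"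
proof (rule ccontr)
  assume "\<not> (f \<longlongrightarrow> l) both_inf"
  then obtain S where S: "open S" "l \<in> S" "\<not> eventually (\<lambda>x. f x \<in> S) both_inf"
    unfolding tendsto_def by blast
  then have "\<forall>N. \<exists>x. fst x \<ge> N \<and> snd x \<ge> N \<and> f x \<notin> S"
    unfolding eventually_prod_sequentially by (metis fst_conv snd_conv)
  then obtain \<sigma> where \<sigma>: "\<And>N. fst (\<sigma> N) \<ge> N" "\<And>N. snd (\<sigma> N) \<ge> N" "\<And>N. f (\<sigma> N) \<notin> S"
    by metis
  have "filterlim (\<lambda>N. (fst (\<sigma> N), snd (\<sigma> N))) both_inf sequentially"
    by (intro filterlim_Pair filterlim_at_top_mono[OF filterlim_ident] always_eventually allI \<sigma>(1,2))
  then have "filterlim \<sigma> both_inf sequentially" by simp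
  then have "\<forall>\<^sub>F k in sequentially. f (\<sigma> k) \<in> S"
    using assms S(1,2) by (blast dest: topological_tendstoD)
  then show False using \<sigma>(3) by (simp add: eventually_sequentially)
qed

lemma weak_conv_both_inf_of_joint_char:
  fixes \<mu> :: "nat \<times> nat \<Rightarrow> (nat \<Rightarrow> real) measure"
  assumes I: "finite I"
    and \<mu>: "\<forall>\<^sub>F n in both_inf. prob_space (\<mu> n) \<and> sets (\<mu> n) = sets (PiM I (\<lambda>_. borel))"
    and \<nu>: "prob_space \<nu>" "sets \<nu> = sets (PiM I (\<lambda>_. borel))"
    and conv: "\<And>t. ((\<lambda>n. joint_char I (\<mu> n) t) \<longlongrightarrow> joint_char I \<nu> t) both_inf"
  shows "weak_conv_along \<mu> \<nu> both_inf"
  unfolding weak_conv_along_def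
proof (intro allI impI, rule tendsto_both_infI)
  have sp: "space \<nu> = PiE I (\<lambda>_. UNIV)"
    using sets_eq_imp_space_eq[OF \<nu>(2)] by (simp add: space_PiM)
  fix g :: "(nat \<Rightarrow> real) \<Rightarrow> real" and \<sigma> :: "nat \<Rightarrow> nat \<times> nat"
  assume g: "continuous_on (space \<nu>) g" "bounded (g ` space \<nu>)"
    and \<sigma>: "filterlim \<sigma> both_inf sequentially"
  define ok where "ok n \<longleftrightarrow> prob_space (\<mu> (\<sigma> n)) \<and> sets (\<mu> (\<sigma> n)) = sets (PiM I (\<lambda>_. borel))" for n
  \<comment> \<open>the finitely many bad terms are replaced by the limit\<close>
  define \<mu>' where "\<mu>' n = (if ok n then \<mu> (\<sigma> n) else \<nu>)" for n
  have "\<forall>\<^sub>F n in sequentially. ok n"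
    unfolding ok_def using \<mu> \<sigma> by (rule eventually_compose_filterlim)
  then have ev: "\<forall>\<^sub>F n in sequentially. \<mu>' n = \<mu> (\<sigma> n)"
    by eventually_elim (simp add: \<mu>'_def)
  have "(\<lambda>n. \<integral>x. g x \<partial>\<mu>' n) \<longlonglongrightarrow> (\<integral>x. g x \<partial>\<nu>)"
  proof (rule multivariate_levy_continuity[OF I _ _ \<nu>])
    show "prob_space (\<mu>' n)" "sets (\<mu>' n) = sets (PiM I (\<lambda>_. borel))" for n
      using \<nu> by (auto simp: \<mu>'_def ok_def)
    show "(\<lambda>n. joint_char I (\<mu>' n) t) \<longlonglongrightarrow> joint_char I \<nu> t" for t
      using filterlim_compose[OF conv \<sigma>]
      by (rule Lim_transform_eventually) (use ev in \<open>auto elim: eventually_mono\<close>)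
  qed (use g in \<open>simp_all add: sp\<close>)
  then show "(\<lambda>n. \<integral>x. g x \<partial>\<mu> (\<sigma> n)) \<longlonglongrightarrow> (\<integral>x. g x \<partial>\<nu>)"
    by (rule Lim_transform_eventually) (use ev in \<open>auto elim: eventually_mono\<close>)
qed

section \<open>Lindeberg's theorem for characteristic functions\<close>

lemma exp_minus_le_quadratic:
  fixes y :: real
  assumes "y \<ge> 0"
  shows "\<bar>exp (- y) - (1 - y)\<bar> \<le> y\<^sup>2 / 2"
proof -
  have "1 + y + y\<^sup>2 / 2 \<le> exp y" using assms by (rule exp_lower_Taylor_quadratic)
  moreover have "0 < 1 - y + y\<^sup>2 / 2"
    using zero_le_power2[of "y - 1"] by (simp add: power2_diff)
  ultimately have "(1 - y + y\<^sup>2 / 2) * (1 + y + y\<^sup>2 / 2) \<le> (1 - y + y\<^sup>2 / 2) * exp y"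
    by (intro mult_left_mono) auto
  moreover have "(1 - y + y\<^sup>2 / 2) * (1 + y + y\<^sup>2 / 2) = 1 + (y\<^sup>2)\<^sup>2 / 4"
    by (simp add: power2_eq_square algebra_simps)
  ultimately have "1 \<le> (1 - y + y\<^sup>2 / 2) * exp y"
    using zero_le_power2[of "y\<^sup>2"] by linarith
  then have "exp (- y) \<le> 1 - y + y\<^sup>2 / 2" by (simp add: exp_minus field_simps)
  moreover have "1 - y \<le> exp (- y)" using exp_ge_add_one_self[of "- y"] by simp
  ultimately show ?thesis using zero_le_power2[of y] by linarith
qed

text \<open>The Taylor remainder of order two is bounded by \<open>X\<^sup>2\<close> where \<open>\<bar>X\<bar> > \<epsilon>\<close> and by \<open>\<epsilon> * X\<^sup>2 / 6\<close>
  elsewhere. The comparison is with \<open>exp (- V / 2)\<close>, where \<open>V\<close> is the variance, rather than with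
  \<open>1 - V / 2\<close>, at the cost of \<open>V\<^sup>2 / 8\<close>: this value lies in the unit disc for every \<open>V\<close>, as needed
  for comparing powers, and its powers are explicit.\<close>
lemma (in prob_space) char_lindeberg_bound:
  fixes X :: "'a \<Rightarrow> real"
  assumes X[measurable]: "random_variable borel X"
    and sq: "integrable M (\<lambda>x. (X x)\<^sup>2)" and mean: "expectation X = 0" and "\<epsilon> > 0"
  shows "cmod ((CLINT x|M. iexp (X x)) - of_real (exp (- expectation (\<lambda>x. (X x)\<^sup>2) / 2))) \<le>
    expectation (\<lambda>x. (X x)\<^sup>2 * indicator {x. \<bar>X x\<bar> > \<epsilon>} x) + \<epsilon> / 6 * expectation (\<lambda>x. (X x)\<^sup>2)
      + (expectation (\<lambda>x. (X x)\<^sup>2))\<^sup>2 / 8"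
proof -
  define V where "V = expectation (\<lambda>x. (X x)\<^sup>2)"
  have V: "V \<ge> 0" unfolding V_def by simp
  have int: "integrable M X" using square_integrable_imp_integrable[OF X sq] .
  define T where "T x = (X x)\<^sup>2 * indicator {x. \<bar>X x\<bar> > \<epsilon>} x" for x
  have ind: "(indicator {x. \<bar>X x\<bar> > \<epsilon>} x :: real) = (if \<bar>X x\<bar> > \<epsilon> then 1 else 0)" for x
    by (simp add: indicator_def)
  have T_meas[measurable]: "T \<in> borel_measurable M"
    unfolding T_def ind by measurable
  have T_int: "integrable M T"
    by (rule Bochner_Integration.integrable_bound[OF sq]) (auto simp: T_def indicator_def)
  have "cmod (char (distr M borel X) 1 - (1 - 1\<^sup>2 * variance X / 2)) \<le>
      (1\<^sup>2 / 6) * expectation (\<lambda>x. min (6 * (X x)^2) (\<bar>1\<bar> * \<bar>X x\<bar>^3))"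
    by (rule char_approx3'[OF X int sq mean refl refl])
  moreover have "char (distr M borel X) 1 = (CLINT x|M. iexp (X x))"
    unfolding char_def by (simp add: integral_distr)
  ultimately have 1: "cmod ((CLINT x|M. iexp (X x)) - of_real (1 - V / 2)) \<le>
      1 / 6 * expectation (\<lambda>x. min (6 * (X x)^2) (\<bar>X x\<bar>^3))"
    by (simp add: V_def mean)
  have "expectation (\<lambda>x. min (6 * (X x)^2) (\<bar>X x\<bar>^3)) \<le> expectation (\<lambda>x. 6 * T x + \<epsilon> * (X x)\<^sup>2)"
  proof (rule integral_mono)
    show "integrable M (\<lambda>x. min (6 * (X x)^2) (\<bar>X x\<bar>^3))"
      by (rule Bochner_Integration.integrable_bound[of _ "\<lambda>x. 6 * (X x)\<^sup>2"]) (use sq in auto)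
    show "min (6 * (X x)^2) (\<bar>X x\<bar>^3) \<le> 6 * T x + \<epsilon> * (X x)\<^sup>2" for x
    proof (cases "\<bar>X x\<bar> > \<epsilon>")
      case True
      then show ?thesis using \<open>\<epsilon> > 0\<close> by (simp add: T_def min.coboundedI1)
    next
      case False
      then have "\<bar>X x\<bar> * (X x)\<^sup>2 \<le> \<epsilon> * (X x)\<^sup>2" by (intro mult_right_mono) auto
      moreover have "\<bar>X x\<bar>^3 = \<bar>X x\<bar> * (X x)\<^sup>2" by (simp add: power3_eq_cube power2_eq_square)
      ultimately show ?thesis using False by (simp add: T_def min.coboundedI2)
    qed
  qed (use T_int sq in auto)
  also have "\<dots> = 6 * expectation T + \<epsilon> * V"
    using T_int sq by (simp add: V_def)
  finally have 2: "cmod ((CLINT x|M. iexp (X x)) - of_real (1 - V / 2)) \<le> expectation T + \<epsilon> / 6 * V"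
    using 1 by linarith
  have "\<bar>exp (- (V / 2)) - (1 - V / 2)\<bar> \<le> V\<^sup>2 / 8"
    using exp_minus_le_quadratic[of "V / 2"] V by (simp add: power_divide)
  then have 3: "cmod (of_real (1 - V / 2) - of_real (exp (- V / 2))) \<le> V\<^sup>2 / 8"
    unfolding of_real_diff[symmetric] norm_of_real by (simp add: abs_minus_commute)
  show ?thesis
    using norm_triangle_ineq[of "(CLINT x|M. iexp (X x)) - of_real (1 - V / 2)"
        "of_real (1 - V / 2) - of_real (exp (- V / 2))"] 2 3
    unfolding V_def[symmetric] T_def[symmetric] by (simp add: algebra_simps)
qed

lemma (in prob_space) norm_char_le_1:
  assumes "random_variable borel X"
  shows "cmod (CLINT x|M. iexp (X x)) \<le> 1"
proof -
  have "cmod (CLINT x|M. iexp (X x)) \<le> (\<integral>x. 1 \<partial>M)"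
    by (rule norm_integral_le) (use integrable_iexp[of "\<lambda>x. complex_of_real (X x)"] assms in auto)
  then show ?thesis by (simp add: prob_space)
qed

text \<open>Lindeberg's central limit theorem for rows of \<open>m n\<close> independent copies of \<open>X n\<close>, stated for the
  characteristic function of the row sum. On the unit disc, \<open>m\<close>-th powers differ by at most \<open>m\<close> times
  the difference of the bases.\<close>
theorem (in prob_space) lindeberg_char_power_tendsto:
  fixes X :: "'n \<Rightarrow> 'a \<Rightarrow> real" and m :: "'n \<Rightarrow> nat"
  assumes rv: "\<forall>\<^sub>F n in F. random_variable borel (X n) \<and> integrable M (\<lambda>x. (X n x)\<^sup>2) \<and> expectation (X n) = 0"
    and var: "((\<lambda>n. real (m n) * expectation (\<lambda>x. (X n x)\<^sup>2)) \<longlongrightarrow> s) F"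
    and small: "((\<lambda>n. expectation (\<lambda>x. (X n x)\<^sup>2)) \<longlongrightarrow> 0) F"
    and tail: "\<And>\<epsilon>. \<epsilon> > 0 \<Longrightarrow>
      ((\<lambda>n. real (m n) * expectation (\<lambda>x. (X n x)\<^sup>2 * indicator {x. \<bar>X n x\<bar> > \<epsilon>} x)) \<longlongrightarrow> 0) F"
  shows "((\<lambda>n. (CLINT x|M. iexp (X n x)) ^ m n) \<longlongrightarrow> of_real (exp (- s / 2))) F"
proof -
  define V where "V n = expectation (\<lambda>x. (X n x)\<^sup>2)" for n
  define L where "L \<epsilon> n = expectation (\<lambda>x. (X n x)\<^sup>2 * indicator {x. \<bar>X n x\<bar> > \<epsilon>} x)" for \<epsilon> n
  define \<phi> where "\<phi> n = (CLINT x|M. iexp (X n x))" for n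
  have V0: "V n \<ge> 0" for n unfolding V_def by simp
  note var' = var[folded V_def] and small' = small[folded V_def] and tail' = tail[folded L_def]
  have bound: "\<forall>\<^sub>F n in F. cmod (\<phi> n ^ m n - of_real (exp (- V n / 2)) ^ m n) \<le>
      real (m n) * L \<epsilon> n + \<epsilon> / 6 * (real (m n) * V n) + (real (m n) * V n) * V n / 8" if "\<epsilon> > 0" for \<epsilon>
    using rv
  proof eventually_elim
    case (elim n)
    have "cmod (\<phi> n ^ m n - of_real (exp (- V n / 2)) ^ m n) \<le>
        real (m n) * cmod (\<phi> n - of_real (exp (- V n / 2)))"
    proof (rule norm_power_diff)
      show "cmod (\<phi> n) \<le> 1" unfolding \<phi>_def using elim by (intro norm_char_le_1) auto
      show "cmod (of_real (exp (- V n / 2))) \<le> 1" using V0[of n] by simp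
    qed
    also have "\<dots> \<le> real (m n) * (L \<epsilon> n + \<epsilon> / 6 * V n + (V n)\<^sup>2 / 8)"
      unfolding \<phi>_def V_def L_def using elim that
      by (intro mult_left_mono char_lindeberg_bound) auto
    finally show ?case by (simp add: algebra_simps power2_eq_square)
  qed
  have "((\<lambda>n. \<phi> n ^ m n - of_real (exp (- V n / 2)) ^ m n) \<longlongrightarrow> 0) F"
  proof (rule tendstoI)
    fix e :: real assume e: "e > 0"
    \<comment> \<open>small enough for the second error term, of limit \<open>\<epsilon> * s / 6\<close>, to stay below e\<close>
    define \<epsilon> where "\<epsilon> = e / (\<bar>s\<bar> + 1)"
    have \<epsilon>: "\<epsilon> > 0" "\<epsilon> / 6 * s < e"
    proof -
      show "\<epsilon> > 0" using e by (simp add: \<epsilon>_def)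
      have "e * s \<le> e * \<bar>s\<bar>" using e by (intro mult_left_mono) auto
      also have "\<dots> < e * (6 * (\<bar>s\<bar> + 1))" using e by (intro mult_strict_left_mono) auto
      finally have "e * s / (6 * (\<bar>s\<bar> + 1)) < e" by (subst pos_divide_less_eq) auto
      then show "\<epsilon> / 6 * s < e" by (simp add: \<epsilon>_def mult.commute)
    qed
    have "((\<lambda>n. real (m n) * L \<epsilon> n + \<epsilon> / 6 * (real (m n) * V n) + (real (m n) * V n) * V n / 8)
        \<longlongrightarrow> 0 + \<epsilon> / 6 * s + s * 0 / 8) F"
      by (intro tendsto_intros tail' var' small' \<epsilon>(1)) simp
    then have "\<forall>\<^sub>F n in F. real (m n) * L \<epsilon> n + \<epsilon> / 6 * (real (m n) * V n) + (real (m n) * V n) * V n / 8 < e"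
      by (rule order_tendstoD) (use \<epsilon>(2) in simp)
    with bound[OF \<epsilon>(1)] show "\<forall>\<^sub>F n in F. dist (\<phi> n ^ m n - of_real (exp (- V n / 2)) ^ m n) 0 < e"
      by eventually_elim (simp add: dist_norm)
  qed
  moreover have "((\<lambda>n. complex_of_real (exp (- (real (m n) * V n) / 2))) \<longlongrightarrow> of_real (exp (- s / 2))) F"
    by (intro tendsto_intros var') simp
  then have "((\<lambda>n. complex_of_real (exp (- V n / 2)) ^ m n) \<longlongrightarrow> of_real (exp (- s / 2))) F"
    by (simp add: of_real_power[symmetric] exp_of_nat_mult[symmetric] del: of_real_power)
  ultimately have "((\<lambda>n. \<phi> n ^ m n - of_real (exp (- V n / 2)) ^ m n + of_real (exp (- V n / 2)) ^ m n)
      \<longlongrightarrow> 0 + of_real (exp (- s / 2))) F"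
    by (rule tendsto_add)
  then show ?thesis by (simp add: \<phi>_def)
qed

text \<open>A sum exceeding \<open>\<epsilon>\<close> is at most \<open>card I\<close> times its largest summand, which therefore exceeds
  \<open>\<epsilon> / card I\<close>. In this way the Lindeberg condition passes from the summands to the sum.\<close>
lemma square_sum_tail_le:
  fixes x :: "'i \<Rightarrow> real"
  assumes I: "finite I"
  shows "(\<Sum>l\<in>I. x l)\<^sup>2 * (if \<bar>\<Sum>l\<in>I. x l\<bar> > \<epsilon> then 1 else 0) \<le>
    (real (card I))\<^sup>2 * (\<Sum>l\<in>I. (x l)\<^sup>2 * (if \<bar>x l\<bar> > \<epsilon> / card I then 1 else 0))"
proof (cases "I = {} \<or> \<not> \<bar>\<Sum>l\<in>I. x l\<bar> > \<epsilon>")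
  case True
  then show ?thesis by (auto intro!: mult_nonneg_nonneg sum_nonneg)
next
  case False
  then have ne: "I \<noteq> {}" and big: "\<bar>\<Sum>l\<in>I. x l\<bar> > \<epsilon>" by auto
  have "Max ((\<lambda>l. \<bar>x l\<bar>) ` I) \<in> (\<lambda>l. \<bar>x l\<bar>) ` I" using I ne by (intro Max_in) auto
  then obtain p where p: "p \<in> I" "\<bar>x p\<bar> = Max ((\<lambda>l. \<bar>x l\<bar>) ` I)" by force
  have le: "\<bar>\<Sum>l\<in>I. x l\<bar> \<le> card I * \<bar>x p\<bar>"
  proof -
    have "\<bar>\<Sum>l\<in>I. x l\<bar> \<le> (\<Sum>l\<in>I. \<bar>x l\<bar>)" by (rule sum_abs)
    also have "\<dots> \<le> of_nat (card I) * \<bar>x p\<bar>"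
      using I p(2) by (intro sum_bounded_above) auto
    finally show ?thesis .
  qed
  have "real (card I) > 0" using I ne by (simp add: card_gt_0_iff)
  then have xp: "\<bar>x p\<bar> > \<epsilon> / card I" using le big by (simp add: divide_less_eq mult.commute)
  have "(\<Sum>l\<in>I. x l)\<^sup>2 \<le> (card I * \<bar>x p\<bar>)\<^sup>2"
    using power_mono[OF le abs_ge_zero, of 2] by simp
  also have "\<dots> = (real (card I))\<^sup>2 * ((x p)\<^sup>2 * (if \<bar>x p\<bar> > \<epsilon> / card I then 1 else 0))"
    using xp by (simp add: power_mult_distrib)
  also have "\<dots> \<le> (real (card I))\<^sup>2 * (\<Sum>l\<in>I. (x l)\<^sup>2 * (if \<bar>x l\<bar> > \<epsilon> / card I then 1 else 0))"
    using I p(1) member_le_sum[of p I "\<lambda>l. (x l)\<^sup>2 * (if \<bar>x l\<bar> > \<epsilon> / card I then 1 else 0)"]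
    by (intro mult_left_mono) auto
  finally show ?thesis using big by simp
qed

section \<open>Factorization of weakly dependent sums\<close>

text \<open>The lexicographic order in which the dependence coefficient compares a block with the later ones.\<close>
definition lex_after :: "nat \<times> nat \<Rightarrow> nat \<times> nat \<Rightarrow> bool" where
  "lex_after j u \<longleftrightarrow> fst u > fst j \<or> fst u = fst j \<and> snd u > snd j"

lemma lex_minimum:
  assumes "finite D" "D \<noteq> {}"
  obtains j where "j \<in> D" "{u \<in> D. lex_after j u} = D - {j}" "\<And>u. u \<in> D \<Longrightarrow> \<not> lex_after u j"
proof -
  have "wf (less_than <*lex*> less_than)" by (intro wf_lex_prod wf_less_than)
  moreover obtain d where "d \<in> D" using assms(2) by blast
  ultimately obtain j where j: "j \<in> D" "\<And>u. (u, j) \<in> less_than <*lex*> less_than \<Longrightarrow> u \<notin> D"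
    by (rule wfE_min) blast
  have nl: "\<not> lex_after u j" if "u \<in> D" for u
    using j(2)[of u] that by (cases u; cases j) (auto simp: lex_after_def)
  have "lex_after j u" if "u \<in> D" "u \<noteq> j" for u
    using nl[OF that(1)] that(2) by (cases u; cases j) (auto simp: lex_after_def)
  then have "{u \<in> D. lex_after j u} = D - {j}" by (auto simp: lex_after_def)
  with j(1) nl show thesis using that by blast
qed

text \<open>Split off the factor of the lexicographically first index \<open>j\<close>. Replacing the expectation of the
  product by the product of expectations costs exactly the covariance belonging to \<open>j\<close>; the remaining
  expectation is then factorized in the same way, and multiplying its error by a number in the unit
  disc does not increase it. Indices after a given \<open>i\<close> are unaffected by removing the first one.\<close>
lemma (in prob_space) char_sum_factorization:
  fixes W :: "nat \<times> nat \<Rightarrow> 'a \<Rightarrow> real"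
  assumes D: "finite D" and W: "\<And>u. u \<in> D \<Longrightarrow> random_variable borel (W u)"
  shows "cmod ((CLINT x|M. iexp (\<Sum>u\<in>D. W u x)) - (\<Prod>u\<in>D. CLINT x|M. iexp (W u x))) \<le>
    (\<Sum>j\<in>D. cmod (cov M (\<lambda>x. iexp (\<Sum>u\<in>{u\<in>D. lex_after j u}. W u x)) (\<lambda>x. iexp (W j x))))"
  using assms
proof (induction D rule: finite_psubset_induct)
  case (psubset D)
  show ?case
  proof (cases "D = {}")
    case True
    then show ?thesis by (simp add: prob_space)
  next
    case False
    obtain j where j: "j \<in> D" "{u \<in> D. lex_after j u} = D - {j}" "\<And>u. u \<in> D \<Longrightarrow> \<not> lex_after u j"
      using lex_minimum[OF psubset.hyps False] by blast
    let ?D = "D - {j}"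
    let ?C = "\<lambda>D j. cmod (cov M (\<lambda>x. iexp (\<Sum>u\<in>{u\<in>D. lex_after j u}. W u x)) (\<lambda>x. iexp (W j x)))"
    define A where "A = (CLINT x|M. iexp (\<Sum>u\<in>?D. W u x))"
    define B where "B = (\<Prod>u\<in>?D. CLINT x|M. iexp (W u x))"
    define b where "b = (CLINT x|M. iexp (W j x))"
    have IH: "cmod (A - B) \<le> (\<Sum>i\<in>?D. ?C ?D i)"
      unfolding A_def B_def using j(1) psubset.prems by (intro psubset.IH) auto
    have C: "?C ?D i = ?C D i" if "i \<in> ?D" for i
    proof -
      have "{u \<in> ?D. lex_after i u} = {u \<in> D. lex_after i u}" using j(3)[of i] that by auto
      then show ?thesis by simp
    qed
    have "(CLINT x|M. iexp (\<Sum>u\<in>D. W u x)) = (CLINT x|M. iexp (\<Sum>u\<in>?D. W u x) * iexp (W j x))"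
    proof (intro Bochner_Integration.integral_cong refl)
      fix x
      have "(\<Sum>u\<in>D. W u x) = (\<Sum>u\<in>?D. W u x) + W j x"
        using sum.remove[OF psubset.hyps j(1), of "\<lambda>u. W u x"] by simp
      then show "iexp (\<Sum>u\<in>D. W u x) = iexp (\<Sum>u\<in>?D. W u x) * iexp (W j x)"
        by (simp add: distrib_left exp_add)
    qed
    then have "(CLINT x|M. iexp (\<Sum>u\<in>D. W u x)) - A * b =
        cov M (\<lambda>x. iexp (\<Sum>u\<in>{u\<in>D. lex_after j u}. W u x)) (\<lambda>x. iexp (W j x))"
      unfolding cov_def j(2) A_def b_def by simp
    then have 1: "cmod ((CLINT x|M. iexp (\<Sum>u\<in>D. W u x)) - A * b) = ?C D j" by simp
    have "cmod b \<le> 1" unfolding b_def using psubset.prems j(1) by (intro norm_char_le_1) auto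
    then have 2: "cmod ((A - B) * b) \<le> cmod (A - B)"
      using mult_left_mono[of "cmod b" 1 "cmod (A - B)"] by (simp add: norm_mult)
    have "(\<Prod>u\<in>D. CLINT x|M. iexp (W u x)) = B * b"
      unfolding B_def b_def using prod.remove[OF psubset.hyps j(1), of "\<lambda>u. CLINT x|M. iexp (W u x)"]
      by (simp add: mult.commute)
    then have eq: "(CLINT x|M. iexp (\<Sum>u\<in>D. W u x)) - (\<Prod>u\<in>D. CLINT x|M. iexp (W u x)) =
        ((CLINT x|M. iexp (\<Sum>u\<in>D. W u x)) - A * b) + (A - B) * b"
      by (simp add: algebra_simps)
    have "cmod ((CLINT x|M. iexp (\<Sum>u\<in>D. W u x)) - (\<Prod>u\<in>D. CLINT x|M. iexp (W u x))) \<le>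
        ?C D j + (\<Sum>i\<in>?D. ?C ?D i)"
      using norm_triangle_ineq[of "(CLINT x|M. iexp (\<Sum>u\<in>D. W u x)) - A * b" "(A - B) * b"] 1 2 IH
      unfolding eq by linarith
    also have "\<dots> = ?C D j + (\<Sum>i\<in>?D. ?C D i)" using C by (intro arg_cong2[of _ _ _ _ "(+)"] refl sum.cong) auto
    also have "\<dots> = (\<Sum>i\<in>D. ?C D i)"
      using sum.remove[OF psubset.hyps j(1), of "?C D"] by simp
    finally show ?thesis .
  qed
qed

section \<open>Linear combinations of square-integrable variables\<close>

lemma integrable_mult_of_squares:
  fixes U V :: "'w \<Rightarrow> real"
  assumes [measurable]: "U \<in> borel_measurable M" "V \<in> borel_measurable M"
    and "integrable M (\<lambda>x. (U x)\<^sup>2)" "integrable M (\<lambda>x. (V x)\<^sup>2)"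
  shows "integrable M (\<lambda>x. U x * V x)"
proof (rule Bochner_Integration.integrable_bound)
  show "integrable M (\<lambda>x. (U x)\<^sup>2 + (V x)\<^sup>2)" using assms by simp
  show "AE x in M. norm (U x * V x) \<le> norm ((U x)\<^sup>2 + (V x)\<^sup>2)"
  proof (rule AE_I2)
    fix x
    have "2 * \<bar>U x\<bar> * \<bar>V x\<bar> \<le> \<bar>U x\<bar>\<^sup>2 + \<bar>V x\<bar>\<^sup>2" by (rule sum_squares_bound)
    moreover have "0 \<le> \<bar>U x\<bar> * \<bar>V x\<bar>" by simp
    ultimately have "\<bar>U x\<bar> * \<bar>V x\<bar> \<le> (U x)\<^sup>2 + (V x)\<^sup>2" unfolding power2_abs by linarith
    then show "norm (U x * V x) \<le> norm ((U x)\<^sup>2 + (V x)\<^sup>2)" by (simp add: abs_mult)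
  qed
qed simp

lemma (in prob_space) square_integrable_shift:
  assumes "random_variable borel U" "integrable M (\<lambda>x. (U x :: real)\<^sup>2)"
  shows "integrable M (\<lambda>x. (U x - d)\<^sup>2)"
  using assms square_integrable_imp_integrable[OF assms] by (simp add: power2_diff)

lemma (in prob_space) cov_centered:
  fixes U V :: "'a \<Rightarrow> real"
  assumes U: "random_variable borel U" "integrable M (\<lambda>x. (U x)\<^sup>2)"
    and V: "random_variable borel V" "integrable M (\<lambda>x. (V x)\<^sup>2)"
  shows "cov M U V = expectation (\<lambda>x. (U x - expectation U) * (V x - expectation V))"
proof -
  note [simp] = square_integrable_imp_integrable[OF U] square_integrable_imp_integrable[OF V]
    integrable_mult_of_squares[OF U(1) V(1) U(2) V(2)]
  have "expectation (\<lambda>x. (U x - expectation U) * (V x - expectation V)) =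
      expectation (\<lambda>x. U x * V x - expectation V * U x - expectation U * V x + expectation U * expectation V)"
    by (intro Bochner_Integration.integral_cong) (auto simp: algebra_simps)
  also have "\<dots> = cov M U V" by (simp add: cov_def prob_space)
  finally show ?thesis by simp
qed

lemma (in prob_space) variance_linear_combination:
  fixes U :: "'i \<Rightarrow> 'a \<Rightarrow> real"
  assumes "\<And>i. i \<in> J \<Longrightarrow> random_variable borel (U i)" "\<And>i. i \<in> J \<Longrightarrow> integrable M (\<lambda>x. (U i x)\<^sup>2)"
  shows "expectation (\<lambda>x. (\<Sum>i\<in>J. t i * (U i x - expectation (U i)))\<^sup>2) =
    quad_form J (\<lambda>i j. cov M (U i) (U j)) t"
proof -
  let ?Z = "\<lambda>i x. U i x - expectation (U i)"
  have int: "integrable M (\<lambda>x. ?Z i x * ?Z j x)" if "i \<in> J" "j \<in> J" for i j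
    by (rule integrable_mult_of_squares) (use that assms in \<open>auto intro: square_integrable_shift\<close>)
  have "expectation (\<lambda>x. (\<Sum>i\<in>J. t i * ?Z i x)\<^sup>2) =
      expectation (\<lambda>x. \<Sum>i\<in>J. \<Sum>j\<in>J. t i * t j * (?Z i x * ?Z j x))"
    unfolding power2_eq_square sum_product by (simp add: mult_ac)
  also have "\<dots> = (\<Sum>i\<in>J. \<Sum>j\<in>J. t i * t j * expectation (\<lambda>x. ?Z i x * ?Z j x))"
    using int by (simp add: Bochner_Integration.integral_sum)
  also have "\<dots> = quad_form J (\<lambda>i j. cov M (U i) (U j)) t"
    unfolding quad_form_def using assms by (intro sum.cong refl) (simp add: cov_centered)
  finally show ?thesis .
qed

lemma quad_form_scale: "quad_form J (\<lambda>i j. z * c i j) t = z * quad_form J c t"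
  by (simp add: quad_form_def sum_distrib_left mult_ac)

lemma quad_form_tendsto:
  assumes "\<And>i j. i \<in> J \<Longrightarrow> j \<in> J \<Longrightarrow> ((\<lambda>n. c n i j) \<longlongrightarrow> c' i j) F"
  shows "((\<lambda>n. quad_form J (c n) t) \<longlongrightarrow> quad_form J c' t) F"
  unfolding quad_form_def by (intro tendsto_sum tendsto_mult tendsto_const assms)

text \<open>Here \<open>a n\<close> is the normalizing constant and \<open>\<rho> n\<close> the order of the covariances of one row variable.
  Since \<open>m n\<close> copies, each of variance of order \<open>\<rho> n / (a n)\<^sup>2\<close>, have total variance of order 1, the
  one-dimensional theorem applies to every linear combination.\<close>
theorem (in prob_space) multivariate_lindeberg_char_power:
  fixes U :: "'n \<Rightarrow> 'i \<Rightarrow> 'a \<Rightarrow> real" and m :: "'n \<Rightarrow> nat" and a \<rho> :: "'n \<Rightarrow> real"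
  assumes I: "finite I"
    and rv: "\<forall>\<^sub>F n in F. \<forall>l\<in>I. random_variable borel (U n l) \<and> integrable M (\<lambda>x. (U n l x)\<^sup>2)"
    and pos: "\<forall>\<^sub>F n in F. a n > 0 \<and> \<rho> n > 0"
    and ratio: "((\<lambda>n. real (m n) * \<rho> n / (a n)\<^sup>2) \<longlongrightarrow> 1) F"
    and small: "((\<lambda>n. \<rho> n / (a n)\<^sup>2) \<longlongrightarrow> 0) F"
    and cov: "\<And>l l'. l \<in> I \<Longrightarrow> l' \<in> I \<Longrightarrow> ((\<lambda>n. 1 / \<rho> n * cov M (U n l) (U n l')) \<longlongrightarrow> C l l') F"
    and tail: "\<And>l \<epsilon>. l \<in> I \<Longrightarrow> \<epsilon> > 0 \<Longrightarrow>
      ((\<lambda>n. 1 / \<rho> n * expectation (\<lambda>x. (U n l x - expectation (U n l))\<^sup>2 *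
          indicator {x. \<bar>U n l x - expectation (U n l)\<bar> > \<epsilon> * a n} x)) \<longlongrightarrow> 0) F"
  shows "((\<lambda>n. (CLINT x|M. iexp (\<Sum>l\<in>I. t l * (1 / a n * (U n l x - expectation (U n l))))) ^ m n)
    \<longlongrightarrow> of_real (exp (- quad_form I C t / 2))) F"
proof (rule lindeberg_char_power_tendsto)
  let ?Z = "\<lambda>n l x. U n l x - expectation (U n l)"
  let ?X = "\<lambda>n x. \<Sum>l\<in>I. t l * (1 / a n * ?Z n l x)"
  let ?Q = "\<lambda>n. quad_form I (\<lambda>l l'. 1 / \<rho> n * cov M (U n l) (U n l')) t"
  have Q: "(?Q \<longlongrightarrow> quad_form I C t) F" by (rule quad_form_tendsto[OF cov])
  have X_eq: "?X n x = 1 / a n * (\<Sum>l\<in>I. t l * ?Z n l x)" for n x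
    by (simp add: sum_distrib_left mult_ac)
  have var: "\<forall>\<^sub>F n in F. expectation (\<lambda>x. (?X n x)\<^sup>2) = \<rho> n / (a n)\<^sup>2 * ?Q n"
    using rv pos
  proof eventually_elim
    case (elim n)
    have "expectation (\<lambda>x. (?X n x)\<^sup>2) = (1 / a n)\<^sup>2 * expectation (\<lambda>x. (\<Sum>l\<in>I. t l * ?Z n l x)\<^sup>2)"
      unfolding X_eq power_mult_distrib by simp
    also have "expectation (\<lambda>x. (\<Sum>l\<in>I. t l * ?Z n l x)\<^sup>2) = quad_form I (\<lambda>l l'. cov M (U n l) (U n l')) t"
      using elim(1) by (intro variance_linear_combination) auto
    moreover have "?Q n = 1 / \<rho> n * quad_form I (\<lambda>l l'. cov M (U n l) (U n l')) t"
      by (rule quad_form_scale)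
    ultimately show ?case using elim(2) by (simp add: power_divide)
  qed
  show "\<forall>\<^sub>F n in F. random_variable borel (?X n) \<and> integrable M (\<lambda>x. (?X n x)\<^sup>2) \<and> expectation (?X n) = 0"
    using rv
  proof eventually_elim
    case (elim n)
    have [measurable]: "U n l \<in> borel_measurable M" if "l \<in> I" for l using elim that by auto
    have sq: "integrable M (\<lambda>x. (?Z n l x)\<^sup>2)" if "l \<in> I" for l
      using elim that by (auto intro: square_integrable_shift[of "U n l"])
    have int: "integrable M (U n l)" if "l \<in> I" for l
      using elim that by (auto intro: square_integrable_imp_integrable[of "U n l"])
    have dbl: "integrable M (\<lambda>x. \<Sum>l\<in>I. \<Sum>l'\<in>I. (t l * (1 / a n)) * (t l' * (1 / a n)) * (?Z n l x * ?Z n l' x))"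
      by (intro Bochner_Integration.integrable_sum integrable_mult_right, rule integrable_mult_of_squares)
        (use sq in auto)
    have X2: "(?X n x)\<^sup>2 = (\<Sum>l\<in>I. \<Sum>l'\<in>I. (t l * (1 / a n)) * (t l' * (1 / a n)) * (?Z n l x * ?Z n l' x))" for x
      unfolding power2_eq_square sum_product by (simp add: mult_ac)
    have "expectation (?X n) = (\<Sum>l\<in>I. t l * (1 / a n * expectation (?Z n l)))"
      using int by (simp add: Bochner_Integration.integral_sum)
    then have "expectation (?X n) = 0" using int by (simp add: prob_space)
    moreover have "random_variable borel (?X n)" by measurable
    moreover have "integrable M (\<lambda>x. (?X n x)\<^sup>2)" unfolding X2 by (rule dbl)
    ultimately show ?case by blast
  qed
  have "((\<lambda>n. real (m n) * \<rho> n / (a n)\<^sup>2 * ?Q n) \<longlongrightarrow> 1 * quad_form I C t) F"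
    by (intro tendsto_mult ratio Q)
  moreover have "\<forall>\<^sub>F n in F. real (m n) * \<rho> n / (a n)\<^sup>2 * ?Q n = real (m n) * expectation (\<lambda>x. (?X n x)\<^sup>2)"
    using var by (rule eventually_mono) simp
  ultimately show "((\<lambda>n. real (m n) * expectation (\<lambda>x. (?X n x)\<^sup>2)) \<longlongrightarrow> quad_form I C t) F"
    unfolding mult_1_left by (rule Lim_transform_eventually)
  have "((\<lambda>n. \<rho> n / (a n)\<^sup>2 * ?Q n) \<longlongrightarrow> 0 * quad_form I C t) F"
    by (intro tendsto_mult small Q)
  moreover have "\<forall>\<^sub>F n in F. \<rho> n / (a n)\<^sup>2 * ?Q n = expectation (\<lambda>x. (?X n x)\<^sup>2)"
    using var by (rule eventually_mono) simp
  ultimately show "((\<lambda>n. expectation (\<lambda>x. (?X n x)\<^sup>2)) \<longlongrightarrow> 0) F"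
    unfolding mult_zero_left by (rule Lim_transform_eventually)
next
  fix \<epsilon> :: real assume "\<epsilon> > 0"
  let ?Z = "\<lambda>n l x. U n l x - expectation (U n l)"
  let ?X = "\<lambda>n x. \<Sum>l\<in>I. t l * (1 / a n * ?Z n l x)"
  let ?T = "\<lambda>n l \<delta>. expectation (\<lambda>x. (?Z n l x)\<^sup>2 * indicator {x. \<bar>?Z n l x\<bar> > \<delta> * a n} x)"
  define K where "K = real (card I)"
  \<comment> \<open>the summand l exceeds \<open>\<epsilon> / K\<close> iff the centered variable exceeds \<open>\<delta> l * a n\<close>\<close>
  define \<delta> where "\<delta> l = \<epsilon> / K / \<bar>t l\<bar>" for l
  define B where "B n = K\<^sup>2 * (\<Sum>l\<in>{l\<in>I. t l \<noteq> 0}. (t l)\<^sup>2 * (real (m n) * \<rho> n / (a n)\<^sup>2 * (1 / \<rho> n * ?T n l (\<delta> l))))" for n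
  have \<delta>: "\<delta> l > 0" if "l \<in> I" "t l \<noteq> 0" for l
  proof -
    have "K > 0" using I that(1) by (auto simp: K_def card_gt_0_iff)
    then show ?thesis using that \<open>\<epsilon> > 0\<close> by (simp add: \<delta>_def)
  qed
  have "(B \<longlongrightarrow> K\<^sup>2 * (\<Sum>l\<in>{l\<in>I. t l \<noteq> 0}. (t l)\<^sup>2 * (1 * 0))) F"
    unfolding B_def by (intro tendsto_mult tendsto_const tendsto_sum ratio tail \<delta>) auto
  then have B: "(B \<longlongrightarrow> 0) F" by simp
  have "\<forall>\<^sub>F n in F. norm (real (m n) * expectation (\<lambda>x. (?X n x)\<^sup>2 * indicator {x. \<bar>?X n x\<bar> > \<epsilon>} x)) \<le> B n"
    using rv pos
  proof eventually_elim
    case (elim n)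
    have [measurable]: "U n l \<in> borel_measurable M" if "l \<in> I" for l using elim that by auto
    have sq: "integrable M (\<lambda>x. (?Z n l x)\<^sup>2)" if "l \<in> I" for l
      using elim that by (auto intro: square_integrable_shift[of "U n l"])
    let ?t = "\<lambda>l x. (?Z n l x)\<^sup>2 * indicator {x. \<bar>?Z n l x\<bar> > \<delta> l * a n} x"
    have t_int: "integrable M (?t l)" if "l \<in> I" for l
    proof (rule Bochner_Integration.integrable_bound[OF sq[OF that]])
      have "?t l = (\<lambda>x. (?Z n l x)\<^sup>2 * (if \<bar>?Z n l x\<bar> > \<delta> l * a n then 1 else 0))"
        by (auto simp: indicator_def)
      then show "?t l \<in> borel_measurable M" using that by simp
    qed (auto simp: indicator_def)
    have pt: "(?X n x)\<^sup>2 * indicator {x. \<bar>?X n x\<bar> > \<epsilon>} x \<le>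
        K\<^sup>2 * (\<Sum>l\<in>{l\<in>I. t l \<noteq> 0}. (t l)\<^sup>2 / (a n)\<^sup>2 * ?t l x)" for x
    proof -
      let ?x = "\<lambda>l. t l * (1 / a n * ?Z n l x)"
      have "(?X n x)\<^sup>2 * indicator {x. \<bar>?X n x\<bar> > \<epsilon>} x =
          (?X n x)\<^sup>2 * (if \<bar>?X n x\<bar> > \<epsilon> then 1 else 0)"
        by (simp only: indicator_def mem_Collect_eq of_bool_def)
      also have "\<dots> \<le> K\<^sup>2 * (\<Sum>l\<in>I. (?x l)\<^sup>2 * (if \<bar>?x l\<bar> > \<epsilon> / K then 1 else 0))"
        unfolding K_def by (rule square_sum_tail_le[OF I])
      also have "(\<Sum>l\<in>I. (?x l)\<^sup>2 * (if \<bar>?x l\<bar> > \<epsilon> / K then 1 else 0)) =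
          (\<Sum>l\<in>{l\<in>I. t l \<noteq> 0}. (t l)\<^sup>2 / (a n)\<^sup>2 * ?t l x)"
      proof (rule sum.mono_neutral_cong_right)
        fix l assume l: "l \<in> {l\<in>I. t l \<noteq> 0}"
        have "\<bar>?x l\<bar> > \<epsilon> / K \<longleftrightarrow> \<bar>?Z n l x\<bar> > \<delta> l * a n"
        proof -
          have "p < w * (1 / \<alpha> * q) \<longleftrightarrow> p / w * \<alpha> < q" if "w > 0" "\<alpha> > 0" for p w q \<alpha> :: real
            using that by (simp add: field_simps)
          moreover have "\<bar>?x l\<bar> = \<bar>t l\<bar> * (1 / a n * \<bar>?Z n l x\<bar>)"
            using elim(2) by (simp add: abs_mult)
          ultimately show ?thesis using l elim(2) by (simp add: \<delta>_def)
        qed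
        then show "(?x l)\<^sup>2 * (if \<bar>?x l\<bar> > \<epsilon> / K then 1 else 0) = (t l)\<^sup>2 / (a n)\<^sup>2 * ?t l x"
          by (simp add: indicator_def power_mult_distrib power_divide)
      qed (use I in auto)
      finally show ?thesis .
    qed
    let ?L = "expectation (\<lambda>x. (?X n x)\<^sup>2 * indicator {x. \<bar>?X n x\<bar> > \<epsilon>} x)"
    have L0: "?L \<ge> 0" by (intro Bochner_Integration.integral_nonneg) simp
    have "?L \<le> expectation (\<lambda>x. K\<^sup>2 * (\<Sum>l\<in>{l\<in>I. t l \<noteq> 0}. (t l)\<^sup>2 / (a n)\<^sup>2 * ?t l x))"
    proof (rule integral_mono'[OF _ pt])
      show "integrable M (\<lambda>x. K\<^sup>2 * (\<Sum>l\<in>{l\<in>I. t l \<noteq> 0}. (t l)\<^sup>2 / (a n)\<^sup>2 * ?t l x))"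
        by (intro Bochner_Integration.integrable_sum integrable_mult_right t_int) simp
    qed (intro mult_nonneg_nonneg sum_nonneg, simp_all)
    also have "\<dots> = K\<^sup>2 * (\<Sum>l\<in>{l\<in>I. t l \<noteq> 0}. (t l)\<^sup>2 / (a n)\<^sup>2 * ?T n l (\<delta> l))"
      using t_int by (simp add: Bochner_Integration.integral_sum)
    finally have "real (m n) * ?L \<le> real (m n) * (K\<^sup>2 * (\<Sum>l\<in>{l\<in>I. t l \<noteq> 0}. (t l)\<^sup>2 / (a n)\<^sup>2 * ?T n l (\<delta> l)))"
      by (rule mult_left_mono) simp
    also have "\<dots> = B n"
      unfolding B_def sum_distrib_left using elim(2) by (intro sum.cong refl) (simp add: field_simps)
    finally show ?case using L0 by simp
  qed
  then show "((\<lambda>n. real (m n) * expectation (\<lambda>x. (?X n x)\<^sup>2 * indicator {x. \<bar>?X n x\<bar> > \<epsilon>} x)) \<longlongrightarrow> 0) F"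
    using B by (rule Lim_null_comparison)
qed

section \<open>Blocks of a stationary field\<close>

text \<open>A block is a fixed measurable function \<open>\<Phi>\<close> of the field shifted to its lower corner, and the shifted
  field has the law of the field. Since the normalized values are known to lie in \<open>E\<close> only along
  the field itself, \<open>\<Phi>\<close> sends every other value to 0, which makes it a map into the arrays over
  \<open>E\<close>.\<close>
lemma block_measurable_and_law:
  fixes X :: "nat \<times> nat \<Rightarrow> 'w \<Rightarrow> 'a :: {real_normed_vector, second_countable_topology}"
  assumes stationary: "stationary_field M X"
    and E: "E \<in> sets borel" "0 \<in> E" and A: "A \<in> sets borel"
    and L: "L n \<in> borel_measurable borel" and b: "b \<in> pos_idx"
    and val: "\<And>\<omega>. \<omega> \<in> space M \<Longrightarrow> block b (normalized A L X n) u \<omega> \<in> arrays E"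
    and val1: "\<And>\<omega>. \<omega> \<in> space M \<Longrightarrow> block b (normalized A L X n) (1, 1) \<omega> \<in> arrays E"
  shows "block b (normalized A L X n) u \<in> M \<rightarrow>\<^sub>M array_space E"
    and "distr M (array_space E) (block b (normalized A L X n) u) =
      distr M (array_space E) (block b (normalized A L X n) (1, 1))"
proof -
  let ?P = "PiM pos_idx (\<lambda>_. borel :: 'a measure)"
  define e where "e z = (if indicator A z *\<^sub>R L n z \<in> E then indicator A z *\<^sub>R L n z else 0)" for z
  define \<psi> where "\<psi> x = (\<lambda>s\<in>grid b. e (x s))" for x :: "nat \<times> nat \<Rightarrow> 'a"
  define \<Phi> where "\<Phi> x = (b, \<psi> x)" for x
  define S where "S h \<omega> = (\<lambda>t\<in>pos_idx. X (fst t + fst h, snd t + snd h) \<omega>)" for h :: "nat \<times> nat" and \<omega>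
  have grid_pos: "grid l \<subseteq> pos_idx" for l by (auto simp: grid_def)
  have X: "X t \<in> borel_measurable M" if "t \<in> pos_idx" for t
    using stationary that unfolding stationary_field_def by blast
  have S: "S h \<in> M \<rightarrow>\<^sub>M ?P" for h
    unfolding S_def by (intro measurable_restrict X) auto
  have S_law: "distr M ?P (S h) = distr M ?P (S (0, 0))" for h
    using stationary unfolding stationary_field_def S_def by simp
  have e: "e \<in> borel \<rightarrow>\<^sub>M restrict_space borel E"
  proof (rule measurable_restrict_space2)
    show "e \<in> borel_measurable borel" unfolding e_def using L E(1) A by measurable
    show "e \<in> space borel \<rightarrow> E" using E(2) by (simp add: e_def)
  qed
  have \<psi>: "\<psi> \<in> ?P \<rightarrow>\<^sub>M PiM (grid b) (\<lambda>_. restrict_space borel E)"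
    unfolding \<psi>_def
    by (intro measurable_restrict measurable_compose[OF measurable_component_singleton[where M = "\<lambda>_. borel"] e])
      (use grid_pos in blast)
  have \<Phi>: "\<Phi> \<in> ?P \<rightarrow>\<^sub>M array_space E"
  proof (rule measurableI)
    fix x assume "x \<in> space ?P"
    then have "\<psi> x \<in> space (PiM (grid b) (\<lambda>_. restrict_space borel E))" by (rule measurable_space[OF \<psi>])
    then show "\<Phi> x \<in> space (array_space E)"
      using b by (simp add: space_array_space \<Phi>_def arrays_def space_PiM space_restrict_space)
  next
    fix B assume "B \<in> sets (array_space E)"
    then have "{x. (b, x) \<in> B} \<in> sets (PiM (grid b) (\<lambda>_. restrict_space borel E))"
      using b unfolding sets_array_space by blast
    from measurable_sets[OF \<psi> this] show "\<Phi> -` B \<inter> space ?P \<in> sets ?P"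
      by (simp add: \<Phi>_def vimage_def)
  qed
  have rep: "block b (normalized A L X n) w \<omega> = \<Phi> (S ((fst w - 1) * fst b, (snd w - 1) * snd b) \<omega>)"
    if "block b (normalized A L X n) w \<omega> \<in> arrays E" for w \<omega>
  proof -
    have "normalized A L X n ((fst w - 1) * fst b + fst s, (snd w - 1) * snd b + snd s) \<omega> \<in> E"
      if "s \<in> grid b" for s
      using \<open>block b (normalized A L X n) w \<omega> \<in> arrays E\<close> that unfolding block_def arrays_def by (auto simp: PiE_iff)
    then have "(\<lambda>s\<in>grid b. normalized A L X n ((fst w - 1) * fst b + fst s, (snd w - 1) * snd b + snd s) \<omega>) =
        \<psi> (S ((fst w - 1) * fst b, (snd w - 1) * snd b) \<omega>)"
      unfolding \<psi>_def using grid_pos[of b]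
      by (intro restrict_ext) (auto simp: S_def e_def normalized_def add.commute subset_iff)
    then show ?thesis by (simp add: block_def \<Phi>_def)
  qed
  have law: "distr M (array_space E) (block b (normalized A L X n) w) = distr (distr M ?P (S (0, 0))) (array_space E) \<Phi>"
    and meas: "block b (normalized A L X n) w \<in> M \<rightarrow>\<^sub>M array_space E"
    if "\<And>\<omega>. \<omega> \<in> space M \<Longrightarrow> block b (normalized A L X n) w \<omega> \<in> arrays E" for w
  proof -
    let ?h = "((fst w - 1) * fst b, (snd w - 1) * snd b)"
    have eq: "block b (normalized A L X n) w \<omega> = \<Phi> (S ?h \<omega>)" if "\<omega> \<in> space M" for \<omega>
      by (rule rep) (fact \<open>\<And>\<omega>. \<omega> \<in> space M \<Longrightarrow> block b (normalized A L X n) w \<omega> \<in> arrays E\<close>[OF that])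
    have "distr M (array_space E) (block b (normalized A L X n) w) = distr M (array_space E) (\<Phi> \<circ> S ?h)"
      by (intro distr_cong) (auto simp: eq)
    also have "\<dots> = distr (distr M ?P (S ?h)) (array_space E) \<Phi>"
      by (rule distr_distr[OF \<Phi> S, symmetric])
    finally show "distr M (array_space E) (block b (normalized A L X n) w) = distr (distr M ?P (S (0, 0))) (array_space E) \<Phi>"
      unfolding S_law[of ?h] .
    show "block b (normalized A L X n) w \<in> M \<rightarrow>\<^sub>M array_space E"
      using measurable_compose[OF S \<Phi>, of ?h] by (simp add: eq cong: measurable_cong)
  qed
  show "block b (normalized A L X n) u \<in> M \<rightarrow>\<^sub>M array_space E" by (rule meas[OF val])
  show "distr M (array_space E) (block b (normalized A L X n) u) =
      distr M (array_space E) (block b (normalized A L X n) (1, 1))"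
    using law[OF val] law[OF val1] by simp
qed

lemma block_in_arrays:
  assumes "b \<in> pos_idx" and u: "u \<in> grid (fst n div fst b, snd n div snd b)"
    and x: "\<And>t. t \<in> grid n \<Longrightarrow> x t \<omega> \<in> E"
  shows "block b x u \<omega> \<in> arrays E"
proof -
  have le: "(k - 1) * r + s \<le> N" if "1 \<le> k" "k \<le> N div r" "s \<le> r" for k r s N :: nat
  proof -
    have "(k - 1) * r + s \<le> (k - 1) * r + r" using that by simp
    also have "\<dots> = k * r" using that(1) by (cases k) auto
    also have "\<dots> \<le> N div r * r" using that(2) by simp
    also have "\<dots> \<le> N" by simp
    finally show ?thesis .
  qed
  have "((fst u - 1) * fst b + fst s, (snd u - 1) * snd b + snd s) \<in> grid n" if "s \<in> grid b" for s
    using that u le[of "fst u" "fst n" "fst b" "fst s"] le[of "snd u" "snd n" "snd b" "snd s"]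
    by (auto simp: grid_def)
  then show ?thesis
    using assms(1) x by (auto simp: block_def arrays_def)
qed

text \<open>The blocks cover all but at most \<open>r n\<close> of the \<open>n\<close> indices of one axis.\<close>
lemma block_count_ratio_tendsto:
  fixes r :: "nat \<Rightarrow> nat"
  assumes "(\<lambda>n. real (r n)) \<in> o(\<lambda>n. real n)" "\<And>n. n \<ge> 1 \<Longrightarrow> r n > 0"
  shows "(\<lambda>n. real (n div r n) * real (r n) / real n) \<longlonglongrightarrow> 1"
proof -
  have 0: "(\<lambda>n. real (r n) / real n) \<longlonglongrightarrow> 0" using smalloD_tendsto[OF assms(1)] .
  have "(\<lambda>n. real (n mod r n) / real n) \<longlonglongrightarrow> 0"
  proof (rule Lim_null_comparison[OF _ 0])
    show "\<forall>\<^sub>F n in sequentially. norm (real (n mod r n) / real n) \<le> real (r n) / real n"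
      using eventually_ge_at_top[of 1]
    proof eventually_elim
      case (elim n)
      then have "n mod r n \<le> r n" using assms(2) by (simp add: less_imp_le)
      then show ?case by (simp add: divide_right_mono)
    qed
  qed
  then have "(\<lambda>n. 1 - real (n mod r n) / real n) \<longlonglongrightarrow> 1 - 0" by (intro tendsto_intros)
  then have "(\<lambda>n. 1 - real (n mod r n) / real n) \<longlonglongrightarrow> 1" by simp
  then show ?thesis
  proof (rule Lim_transform_eventually)
    show "\<forall>\<^sub>F n in sequentially. 1 - real (n mod r n) / real n = real (n div r n) * real (r n) / real n"
      using eventually_ge_at_top[of 1]
    proof eventually_elim
      case (elim n)
      have "real n = real (n div r n) * real (r n) + real (n mod r n)"
        by (metis div_mult_mod_eq of_nat_add of_nat_mult)
      then show ?case using elim by (simp add: field_simps)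
    qed
  qed
qed

lemma eventually_one_le_div:
  fixes r :: "nat \<Rightarrow> nat"
  assumes "(\<lambda>n. real (r n)) \<in> o(\<lambda>n. real n)" "\<And>n. n \<ge> 1 \<Longrightarrow> r n > 0"
  shows "\<forall>\<^sub>F n in sequentially. 1 \<le> n div r n"
proof -
  have "\<forall>\<^sub>F n in sequentially. 0 < real (n div r n) * real (r n) / real n"
    by (rule order_tendstoD(1)[OF block_count_ratio_tendsto[of r, OF assms], of 0]) simp_all
  then show ?thesis
    by eventually_elim (auto simp: zero_less_mult_iff zero_less_divide_iff intro: Suc_leI)
qed

section \<open>The Gaussian limit process\<close>

text \<open>Mean and variance of linear combinations of coordinates come from their characteristic functions,
  and the covariances from the variance of \<open>x i + x j\<close>.\<close>
theorem centered_gaussian_process_exists: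
  fixes I :: "'i set"
  assumes c: "psd_on I c"
  shows "\<exists>N. prob_space N \<and> sets N = sets (PiM I (\<lambda>_. borel)) \<and>
    (\<forall>J t. finite J \<longrightarrow> J \<subseteq> I \<longrightarrow> joint_char J N t = of_real (exp (- quad_form J c t / 2))) \<and>
    centered_gaussian_process N I (\<lambda>i x. x i) c"
proof -
  obtain N :: "('i \<Rightarrow> real) measure" where N: "prob_space N" "sets N = sets (PiM I (\<lambda>_. borel))"
    and char: "\<And>J t. finite J \<Longrightarrow> J \<subseteq> I \<Longrightarrow> joint_char J N t = of_real (exp (- quad_form J c t / 2))"
    using gaussian_field_exists[OF c] by blast
  have coord: "(\<lambda>x. x i) \<in> borel_measurable N" if "i \<in> I" for i
    unfolding measurable_cong_sets[OF N(2) refl]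
    using measurable_component_singleton[of i I "\<lambda>_. borel :: real measure"] that by simp
  have U_meas: "(\<lambda>x. \<Sum>i\<in>J. t i * x i) \<in> borel_measurable N" if "J \<subseteq> I" for J t
    using that by (intro borel_measurable_sum borel_measurable_times borel_measurable_const coord) auto
  have q: "0 \<le> quad_form J c t" if "finite J" "J \<subseteq> I" for J t
    using c that unfolding psd_on_def by blast
  have U_char: "(CLINT x|N. iexp (s * (\<Sum>i\<in>J. t i * x i))) = of_real (exp (- (s\<^sup>2 * quad_form J c t) / 2))"
    if J: "finite J" "J \<subseteq> I" for J t s
  proof -
    have "(CLINT x|N. iexp (s * (\<Sum>i\<in>J. t i * x i))) = joint_char J N (\<lambda>i. s * t i)"
      unfolding joint_char_def by (simp add: sum_distrib_left mult.assoc)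
    also have "\<dots> = of_real (exp (- quad_form J c (\<lambda>i. s * t i) / 2))" by (rule char[OF J])
    also have "quad_form J c (\<lambda>i. s * t i) = s\<^sup>2 * quad_form J c t"
      by (simp add: quad_form_def sum_distrib_left power2_eq_square mult_ac)
    finally show ?thesis .
  qed
  note normal = centered_normal_of_char[OF N(1) U_meas q U_char]
  have single: "(\<integral>x. x i \<partial>N) = 0" "integrable N (\<lambda>x. (x i)\<^sup>2)" "(\<integral>x. (x i)\<^sup>2 \<partial>N) = c i i" if "i \<in> I" for i
    using normal(2-4)[of "{i}" "\<lambda>_. 1"] that by (auto simp: quad_form_def)
  have cov: "cov N (\<lambda>x. x i) (\<lambda>x. x j) = c i j" if ij: "i \<in> I" "j \<in> I" for i j
  proof (cases "i = j")
    case True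
    then show ?thesis using single[OF ij(1)] by (simp add: cov_def power2_eq_square)
  next
    case False
    have prod: "integrable N (\<lambda>x. x i * x j)"
      using coord single ij by (intro integrable_mult_of_squares) auto
    have sym: "c j i = c i j" using c ij unfolding psd_on_def by blast
    have "(\<integral>x. (x i + x j)\<^sup>2 \<partial>N) = c i i + 2 * c i j + c j j"
      using normal(4)[of "{i, j}" "\<lambda>_. 1"] ij False sym by (simp add: quad_form_def)
    moreover have "(\<integral>x. (x i + x j)\<^sup>2 \<partial>N) = (\<integral>x. (x i)\<^sup>2 + (x j)\<^sup>2 + 2 * (x i * x j) \<partial>N)"
      by (simp add: power2_sum mult.assoc)
    then have "(\<integral>x. (x i + x j)\<^sup>2 \<partial>N) = c i i + c j j + 2 * (\<integral>x. x i * x j \<partial>N)"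
      using single ij prod by simp
    ultimately show ?thesis using single(1) ij by (simp add: cov_def)
  qed
  have "centered_gaussian_process N I (\<lambda>i x. x i) c"
    unfolding centered_gaussian_process_def gaussian_process_def
    using N(1) normal(1) single(1) cov by blast
  then show ?thesis using N char by blast
qed

text \<open>A tuple of functionals may contain the same functional several times; its coefficients are then
  collected.\<close>
lemma sum_over_fibres:
  fixes t :: "'l \<Rightarrow> real"
  assumes "finite K"
  shows "(\<Sum>f\<in>h ` K. (\<Sum>l\<in>{l \<in> K. h l = f}. t l) * y f) = (\<Sum>l\<in>K. t l * y (h l))"
proof -
  have "(\<Sum>l\<in>K. t l * y (h l)) = (\<Sum>f\<in>h ` K. \<Sum>l\<in>{l \<in> K. h l = f}. t l * y (h l))"
    by (rule sum.image_gen[OF assms])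
  also have "\<dots> = (\<Sum>f\<in>h ` K. \<Sum>l\<in>{l \<in> K. h l = f}. t l * y f)"
    by (intro sum.cong refl) auto
  finally show ?thesis by (simp add: sum_distrib_right)
qed

lemma joint_char_fidi:
  assumes "(\<lambda>\<omega>. \<lambda>l\<in>{1..k}. U l \<omega>) \<in> M \<rightarrow>\<^sub>M PiM {1..k} (\<lambda>_. borel)"
  shows "joint_char {1..k} (fidi M k U) t = (CLINT \<omega>|M. iexp (\<Sum>l\<in>{1..k}. t l * U l \<omega>))"
  unfolding joint_char_def fidi_def using assms by (subst integral_distr) auto

lemma joint_char_fidi_gaussian:
  assumes N: "sets N = sets (PiM I (\<lambda>_. borel))"
    and char: "\<And>J t. finite J \<Longrightarrow> J \<subseteq> I \<Longrightarrow> joint_char J N t = of_real (exp (- quad_form J c t / 2))"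
    and h: "h \<in> {1..k} \<rightarrow> I"
  shows "joint_char {1..k} (fidi N k (\<lambda>l x. x (h l))) t =
    of_real (exp (- quad_form {1..k} (\<lambda>l l'. c (h l) (h l')) t / 2))"
proof -
  define J where "J = h ` {1..k}"
  have J: "finite J" "J \<subseteq> I" using h by (auto simp: J_def)
  define s where "s f = (\<Sum>l\<in>{l \<in> {1..k}. h l = f}. t l)" for f
  have fib: "(\<Sum>f\<in>J. s f * y f) = (\<Sum>l\<in>{1..k}. t l * y (h l))" for y
    unfolding J_def s_def by (rule sum_over_fibres) simp
  have "(\<lambda>x. \<lambda>l\<in>{1..k}. x (h l)) \<in> N \<rightarrow>\<^sub>M PiM {1..k} (\<lambda>_. borel)"
    unfolding measurable_cong_sets[OF N refl] by (rule measurable_reindex) (use h in auto)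
  then have "joint_char {1..k} (fidi N k (\<lambda>l x. x (h l))) t = joint_char J N s"
    by (simp only: joint_char_fidi fib joint_char_def[of J])
  also have "\<dots> = of_real (exp (- quad_form J c s / 2))" by (rule char[OF J])
  also have "quad_form J c s = (\<Sum>f\<in>J. s f * (\<Sum>g\<in>J. s g * c f g))"
    by (simp add: quad_form_def sum_distrib_left mult.assoc)
  also have "\<dots> = quad_form {1..k} (\<lambda>l l'. c (h l) (h l')) t"
    unfolding fib by (simp add: quad_form_def sum_distrib_left mult.assoc)
  finally show ?thesis .
qed

lemma filterlim_fst_both_inf: "filterlim fst sequentially both_inf"
  and filterlim_snd_both_inf: "filterlim snd sequentially both_inf"
  unfolding filterlim_at_top eventually_prod_sequentially by auto

text \<open>Positive semidefiniteness holds before the limit, where the quadratic form is a variance.\<close>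
lemma cov_limit_psd:
  fixes U :: "'n \<Rightarrow> 'i \<Rightarrow> 'a \<Rightarrow> real" and \<rho> :: "'n \<Rightarrow> real"
  assumes M: "prob_space M" and F: "F \<noteq> bot" and pos: "\<And>n. \<rho> n \<ge> 0"
    and rv: "\<And>i. i \<in> I \<Longrightarrow> \<forall>\<^sub>F n in F. U n i \<in> borel_measurable M \<and> integrable M (\<lambda>x. (U n i x)\<^sup>2)"
    and lim: "\<And>i j. i \<in> I \<Longrightarrow> j \<in> I \<Longrightarrow> ((\<lambda>n. 1 / \<rho> n * cov M (U n i) (U n j)) \<longlongrightarrow> c i j) F"
  shows "psd_on I c"
  unfolding psd_on_def
proof (intro conjI ballI allI impI)
  fix i j assume ij: "i \<in> I" "j \<in> I"
  have "cov M (U n i) (U n j) = cov M (U n j) (U n i)" for n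
    by (simp add: cov_def mult.commute)
  then show "c i j = c j i"
    using tendsto_unique[OF F lim[OF ij]] lim[OF ij(2,1)] by simp
next
  fix J and t :: "'i \<Rightarrow> real" assume J: "finite J" "J \<subseteq> I"
  have "((\<lambda>n. quad_form J (\<lambda>i j. 1 / \<rho> n * cov M (U n i) (U n j)) t) \<longlongrightarrow> quad_form J c t) F"
    using J(2) by (intro quad_form_tendsto lim) auto
  moreover have "\<forall>\<^sub>F n in F. \<forall>i\<in>J. U n i \<in> borel_measurable M \<and> integrable M (\<lambda>x. (U n i x)\<^sup>2)"
    using J rv by (intro eventually_ball_finite) auto
  then have "\<forall>\<^sub>F n in F. 0 \<le> quad_form J (\<lambda>i j. 1 / \<rho> n * cov M (U n i) (U n j)) t"
  proof eventually_elim
    case (elim n)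
    have "0 \<le> (\<integral>x. (\<Sum>i\<in>J. t i * (U n i x - (\<integral>x. U n i x \<partial>M)))\<^sup>2 \<partial>M)" by simp
    also have "\<dots> = quad_form J (\<lambda>i j. cov M (U n i) (U n j)) t"
      using elim by (intro prob_space.variance_linear_combination[OF M]) auto
    finally show ?case using pos[of n] unfolding quad_form_scale by simp
  qed
  ultimately show "0 \<le> quad_form J c t" using F by (rule tendsto_lowerbound)
qed

section \<open>The central limit theorem for cluster functionals\<close>

theorem theorem3:
  fixes M :: "'w measure"
    and X :: "nat \<times> nat \<Rightarrow> 'w \<Rightarrow> real ^ 'q"
    and E A :: "(real ^ 'q) set"
    and L :: "nat \<times> nat \<Rightarrow> real ^ 'q \<Rightarrow> real ^ 'q"
    and G :: "(real ^ 'q) measure"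
    and r1 r2 :: "nat \<Rightarrow> nat"
    and \<F> :: "((real ^ 'q) arr \<Rightarrow> real) set"
    and \<tau> :: real
    and c :: "((real ^ 'q) arr \<Rightarrow> real) \<Rightarrow> ((real ^ 'q) arr \<Rightarrow> real) \<Rightarrow> real"
    and Xn :: "nat \<times> nat \<Rightarrow> nat \<times> nat \<Rightarrow> 'w \<Rightarrow> real ^ 'q"
    and Y :: "nat \<times> nat \<Rightarrow> nat \<times> nat \<Rightarrow> 'w \<Rightarrow> (real ^ 'q) arr"
    and D :: "nat \<times> nat \<Rightarrow> (nat \<times> nat) set"
    and r v a :: "nat \<times> nat \<Rightarrow> real"
  assumes prob: "prob_space M"
    and stationary: "stationary_field M X"
    and E: "E \<in> sets borel" "0 \<in> E"
    and A: "A \<in> sets borel" "A \<subseteq> E - {0}"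
    and L: "\<And>n. n \<in> pos_idx \<Longrightarrow> L n \<in> borel_measurable borel"
    and r_pos: "\<And>n. n \<ge> 1 \<Longrightarrow> r1 n > 0" "\<And>n. n \<ge> 1 \<Longrightarrow> r2 n > 0"
    and F: "\<And>f. f \<in> \<F> \<Longrightarrow> cluster_functional E A f"
    \<comment> \<open>notation\<close>
    and Xn: "\<And>n. Xn n = normalized A L X n"
    and Y: "\<And>n. Y n = block (r1 (fst n), r2 (snd n)) (Xn n)"
    and D: "\<And>n. D n = grid (fst n div r1 (fst n), snd n div r2 (snd n))"
    and r: "\<And>n. r n = real (r1 (fst n) * r2 (snd n))"
    and v: "\<And>n. v n = measure M {\<omega> \<in> space M. Xn n (1, 1) \<omega> \<in> A}"
    and a: "\<And>n. a n = sqrt (real (fst n * snd n) * v n)"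
    \<comment> \<open>normalized observations\<close>
    and Xn_E: "\<And>n t \<omega>. n \<in> pos_idx \<Longrightarrow> t \<in> grid n \<Longrightarrow> \<omega> \<in> space M \<Longrightarrow> Xn n t \<omega> \<in> E"
    and G: "prob_space G" "sets G = sets borel" "\<And>x. G \<noteq> return borel x"
    and Xn_G: "weak_conv_along
      (\<lambda>n. distr (uniform_measure M {\<omega> \<in> space M. Xn n (1, 1) \<omega> \<in> A}) borel (Xn n (1, 1)))
      G both_inf"
    \<comment> \<open>the moments in the remaining conditions exist\<close>
    and square_integrable: "\<And>f. f \<in> \<F> \<Longrightarrow>
      \<forall>\<^sub>F n in both_inf. integrable M (\<lambda>\<omega>. (f (Y n (1, 1) \<omega>))\<^sup>2)"
    and cond1: "(\<lambda>n. real (r1 n)) \<in> o(\<lambda>n. real n)" "(\<lambda>n. real (r2 n)) \<in> o(\<lambda>n. real n)"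
      "((\<lambda>n. r n * v n) \<longlongrightarrow> \<tau>) both_inf"
      "filterlim (\<lambda>n. real (fst n * snd n) * v n) at_top both_inf"
    and cond2: "\<And>\<epsilon> f. \<epsilon> > 0 \<Longrightarrow> f \<in> \<F> \<Longrightarrow>
      ((\<lambda>n. 1 / (r n * v n) *
          (\<integral>\<omega>. (f (Y n (1, 1) \<omega>) - (\<integral>\<omega>'. f (Y n (1, 1) \<omega>') \<partial>M))\<^sup>2 *
               indicator {\<omega>. \<bar>f (Y n (1, 1) \<omega>) - (\<integral>\<omega>'. f (Y n (1, 1) \<omega>') \<partial>M)\<bar> > \<epsilon> * a n} \<omega> \<partial>M))
        \<longlongrightarrow> 0) both_inf"
    and cond3: "\<And>f g. f \<in> \<F> \<Longrightarrow> g \<in> \<F> \<Longrightarrow>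
      ((\<lambda>n. 1 / (r n * v n) * cov M (\<lambda>\<omega>. f (Y n (1, 1) \<omega>)) (\<lambda>\<omega>. g (Y n (1, 1) \<omega>)))
        \<longlongrightarrow> c f g) both_inf"
    and cond4: "\<And>k t fs. fs \<in> {1..k} \<rightarrow> \<F> \<Longrightarrow>
      ((\<lambda>n. dep_coeff M (D n) (Y n) (a n) k t fs) \<longlongrightarrow> 0) both_inf"
  shows "\<exists>(N :: (((real ^ 'q) arr \<Rightarrow> real) \<Rightarrow> real) measure) Z.
    centered_gaussian_process N \<F> Z c \<and>
    (\<forall>k fs. fs \<in> {1..k} \<rightarrow> \<F> \<longrightarrow>
       weak_conv_along
         (\<lambda>n. fidi M k (\<lambda>l. empirical M (D n) (Y n) (a n) (fs l)))
         (fidi N k (\<lambda>l. Z (fs l))) both_inf)"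
proof -
  interpret prob_space M by (rule prob)
  define b where "b n = (r1 (fst n), r2 (snd n))" for n
  \<comment> \<open>the indices for which there is at least one block and the normalization is not degenerate\<close>
  define good where "good n \<longleftrightarrow> n \<in> pos_idx \<and> 1 \<le> fst n div r1 (fst n) \<and> 1 \<le> snd n div r2 (snd n) \<and>
    real (fst n * snd n) * v n > 0" for n
  have v0: "v n \<ge> 0" for n by (simp add: v)
  have r0: "r n \<ge> 0" for n by (simp add: r)
  have a2: "(a n)\<^sup>2 = real (fst n * snd n) * v n" for n using v0[of n] by (simp add: a)
  have ev_good: "\<forall>\<^sub>F n in both_inf. good n"
  proof -
    have "\<forall>\<^sub>F n in both_inf. 1 \<le> fst n div r1 (fst n)" "\<forall>\<^sub>F n in both_inf. 1 \<le> snd n div r2 (snd n)"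
      using eventually_compose_filterlim[OF eventually_one_le_div[OF cond1(1) r_pos(1)] filterlim_fst_both_inf]
        eventually_compose_filterlim[OF eventually_one_le_div[OF cond1(2) r_pos(2)] filterlim_snd_both_inf]
      by simp_all
    moreover have "\<forall>\<^sub>F n in both_inf. real (fst n * snd n) * v n > 0"
      using cond1(4) by (simp add: filterlim_at_top_dense)
    ultimately show ?thesis
    proof eventually_elim
      case (elim n)
      then have "1 \<le> fst n" "1 \<le> snd n" by (auto intro!: Suc_leI gr0I)
      then show ?case using elim by (simp add: good_def mem_Times_iff)
    qed
  qed
  have good_pos: "n \<in> pos_idx" "b n \<in> pos_idx" "(1, 1) \<in> D n" "a n > 0" "r n * v n > 0" if "good n" for n
  proof -
    show n: "n \<in> pos_idx" using that by (simp add: good_def)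
    then have "r1 (fst n) > 0" "r2 (snd n) > 0" using r_pos by (auto simp: mem_Times_iff)
    then show "b n \<in> pos_idx" by (auto simp: b_def)
    show "(1, 1) \<in> D n" using that by (simp add: good_def D grid_def)
    show "a n > 0" using that by (simp add: good_def a)
    have "v n > 0" using that v0[of n] by (auto simp: good_def zero_less_mult_iff)
    then show "r n * v n > 0" using \<open>r1 (fst n) > 0\<close> \<open>r2 (snd n) > 0\<close> by (simp add: r)
  qed
  have block: "Y n u \<in> M \<rightarrow>\<^sub>M array_space E"
      "distr M (array_space E) (Y n u) = distr M (array_space E) (Y n (1, 1))"
    if n: "good n" and u: "u \<in> D n" for n u
  proof -
    have val: "block (b n) (normalized A L X n) w \<omega> \<in> arrays E" if "\<omega> \<in> space M" "w \<in> D n" for w \<omega>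
      using good_pos[OF n] that by (intro block_in_arrays[of _ _ n]) (auto simp: D b_def intro!: Xn_E[unfolded Xn])
    note * = block_measurable_and_law[OF stationary E A(1) L[OF good_pos(1)[OF n]] good_pos(2)[OF n]
        val[OF _ u] val[OF _ good_pos(3)[OF n]]]
    have Yn: "Y n = block (b n) (normalized A L X n)" by (simp add: Y Xn b_def)
    show "Y n u \<in> M \<rightarrow>\<^sub>M array_space E" unfolding Yn by (rule *(1))
    show "distr M (array_space E) (Y n u) = distr M (array_space E) (Y n (1, 1))"
      unfolding Yn by (rule *(2))
  qed
  have f_meas: "f \<in> borel_measurable (array_space E)" if "f \<in> \<F>" for f
    using F[OF that] by (simp add: cluster_functional_def)
  have fY: "(\<lambda>\<omega>. f (Y n u \<omega>)) \<in> borel_measurable M" if "f \<in> \<F>" "good n" "u \<in> D n" for f n u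
    using measurable_compose[OF block(1)[OF that(2,3)] f_meas[OF that(1)]] .
  have law: "(\<integral>\<omega>. H (Y n u \<omega>) \<partial>M) = (\<integral>\<omega>. H (Y n (1, 1) \<omega>) \<partial>M)"
    if "good n" "u \<in> D n" "H \<in> borel_measurable (array_space E)" for H :: "_ \<Rightarrow> 'z :: {banach, second_countable_topology}" and n u
    using integral_distr[OF block(1)[OF that(1,2)] that(3)]
      integral_distr[OF block(1)[OF that(1) good_pos(3)[OF that(1)]] that(3)] block(2)[OF that(1,2)] by simp
  have rv: "\<forall>\<^sub>F n in both_inf. (\<lambda>\<omega>. f (Y n (1, 1) \<omega>)) \<in> borel_measurable M \<and> integrable M (\<lambda>\<omega>. (f (Y n (1, 1) \<omega>))\<^sup>2)"
    if "f \<in> \<F>" for f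
    using ev_good square_integrable[OF that]
    by eventually_elim (rule conjI[OF fY[OF that _ good_pos(3)]])
  \<comment> \<open>the variance of one block is of order r v, and there are about \<open>n / r\<close> blocks\<close>
  have ratio: "((\<lambda>n. real (card (D n)) * (r n * v n) / (a n)\<^sup>2) \<longlongrightarrow> 1) both_inf"
  proof -
    let ?q = "\<lambda>\<rho> n. real (n div \<rho> n) * real (\<rho> n) / real n"
    have "((\<lambda>n. ?q r1 (fst n) * ?q r2 (snd n)) \<longlongrightarrow> 1 * 1) both_inf"
      by (intro tendsto_mult filterlim_compose[OF block_count_ratio_tendsto[OF cond1(1) r_pos(1)] filterlim_fst_both_inf]
          filterlim_compose[OF block_count_ratio_tendsto[OF cond1(2) r_pos(2)] filterlim_snd_both_inf])
    moreover have "\<forall>\<^sub>F n in both_inf. ?q r1 (fst n) * ?q r2 (snd n) = real (card (D n)) * (r n * v n) / (a n)\<^sup>2"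
      using ev_good
    proof eventually_elim
      case (elim n)
      then have "v n > 0" using v0[of n] by (auto simp: good_def zero_less_mult_iff)
      then show ?case by (simp add: D grid_def r a2)
    qed
    ultimately show ?thesis unfolding mult_1_left by (rule Lim_transform_eventually)
  qed
  have small: "((\<lambda>n. r n * v n / (a n)\<^sup>2) \<longlongrightarrow> 0) both_inf"
    unfolding a2 by (rule tendsto_divide_0[OF cond1(3) filterlim_at_top_imp_at_infinity[OF cond1(4)]])
  have both_inf_ne: "both_inf \<noteq> bot" by (simp add: prod_filter_eq_bot)
  have psd: "psd_on \<F> c"
    by (rule cov_limit_psd[OF prob both_inf_ne _ rv cond3]) (use r0 v0 in simp)
  obtain N :: "(((real ^ 'q) arr \<Rightarrow> real) \<Rightarrow> real) measure" where
    N: "prob_space N" "sets N = sets (PiM \<F> (\<lambda>_. borel))" "centered_gaussian_process N \<F> (\<lambda>f x. x f) c"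
    and N_char: "\<And>J t. finite J \<Longrightarrow> J \<subseteq> \<F> \<Longrightarrow> joint_char J N t = of_real (exp (- quad_form J c t / 2))"
    using centered_gaussian_process_exists[OF psd] by blast
  have "weak_conv_along (\<lambda>n. fidi M k (\<lambda>l. empirical M (D n) (Y n) (a n) (fs l)))
      (fidi N k (\<lambda>l x. x (fs l))) both_inf" if fs: "fs \<in> {1..k} \<rightarrow> \<F>" for k fs
  proof (rule weak_conv_both_inf_of_joint_char)
    have fsl: "fs l \<in> \<F>" if "l \<in> {1..k}" for l using fs that by auto
    have emp_meas: "(\<lambda>\<omega>. \<lambda>l\<in>{1..k}. empirical M (D n) (Y n) (a n) (fs l) \<omega>) \<in> M \<rightarrow>\<^sub>M PiM {1..k} (\<lambda>_. borel)"
      if "good n" for n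
      unfolding empirical_def using fY[OF fsl that] by (intro measurable_restrict) simp
    show "\<forall>\<^sub>F n in both_inf. prob_space (fidi M k (\<lambda>l. empirical M (D n) (Y n) (a n) (fs l))) \<and>
        sets (fidi M k (\<lambda>l. empirical M (D n) (Y n) (a n) (fs l))) = sets (PiM {1..k} (\<lambda>_. borel))"
      using ev_good unfolding fidi_def by eventually_elim (intro conjI prob_space_distr emp_meas sets_distr)
    have "(\<lambda>x. \<lambda>l\<in>{1..k}. x (fs l)) \<in> N \<rightarrow>\<^sub>M PiM {1..k} (\<lambda>_. borel)"
      unfolding measurable_cong_sets[OF N(2) refl] by (rule measurable_reindex[OF fsl])
    then show "prob_space (fidi N k (\<lambda>l x. x (fs l)))"
      unfolding fidi_def by (rule prob_space.prob_space_distr[OF N(1)])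
    show "sets (fidi N k (\<lambda>l x. x (fs l))) = sets (PiM {1..k} (\<lambda>_. borel))" by (simp add: fidi_def)
    fix t :: "nat \<Rightarrow> real"
    define C where "C l l' = c (fs l) (fs l')" for l l'
    define W where "W n u \<omega> = (\<Sum>l\<in>{1..k}. t l * block_vector M (Y n) (a n) fs u \<omega> l)" for n u \<omega>
    define \<phi> where "\<phi> n = (CLINT \<omega>|M. iexp (W n (1, 1) \<omega>))" for n
    \<comment> \<open>the limit that the row sums would have if the blocks were independent\<close>
    have power: "((\<lambda>n. \<phi> n ^ card (D n)) \<longlongrightarrow> of_real (exp (- quad_form {1..k} C t / 2))) both_inf"
      unfolding \<phi>_def W_def block_vector_def
    proof (rule multivariate_lindeberg_char_power[where \<rho> = "\<lambda>n. r n * v n"])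
      show "\<forall>\<^sub>F n in both_inf. \<forall>l\<in>{1..k}. (\<lambda>\<omega>. fs l (Y n (1, 1) \<omega>)) \<in> borel_measurable M \<and>
          integrable M (\<lambda>\<omega>. (fs l (Y n (1, 1) \<omega>))\<^sup>2)"
        by (intro eventually_ball_finite ballI rv fsl) auto
      show "\<forall>\<^sub>F n in both_inf. a n > 0 \<and> r n * v n > 0"
        using ev_good by eventually_elim (simp add: good_pos)
    qed (use ratio small cond2 cond3 fsl in \<open>simp_all add: C_def\<close>)
    have sums: "(\<Sum>l\<in>{1..k}. t l * (\<Sum>u\<in>S. block_vector M (Y n) (a n) fs u \<omega> l)) = (\<Sum>u\<in>S. W n u \<omega>)" for S n \<omega>
      unfolding W_def sum_distrib_left by (rule sum.swap)
    have emp: "joint_char {1..k} (fidi M k (\<lambda>l. empirical M (D n) (Y n) (a n) (fs l))) t =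
        (CLINT \<omega>|M. iexp (\<Sum>u\<in>D n. W n u \<omega>))" if "good n" for n
    proof -
      have "empirical M (D n) (Y n) (a n) (fs l) \<omega> = (\<Sum>u\<in>D n. block_vector M (Y n) (a n) fs u \<omega> l)" for l \<omega>
        by (simp add: empirical_def block_vector_def sum_distrib_left)
      then show ?thesis by (simp only: joint_char_fidi[OF emp_meas[OF that]] sums)
    qed
    have W_law: "(CLINT \<omega>|M. iexp (W n u \<omega>)) = \<phi> n" if "good n" "u \<in> D n" for n u
    proof -
      define m where "m l = (\<integral>\<omega>. fs l (Y n (1, 1) \<omega>) \<partial>M)" for l
      define H where "H y = iexp (\<Sum>l\<in>{1..k}. t l * (1 / a n * (fs l y - m l)))" for y
      have [measurable]: "fs l \<in> borel_measurable (array_space E)" if "l \<in> {1..k}" for l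
        by (rule f_meas[OF fsl[OF that]])
      have "iexp (W n w \<omega>) = H (Y n w \<omega>)" if "w \<in> D n" for w \<omega>
        unfolding W_def H_def block_vector_def
        using law[OF \<open>good n\<close> that f_meas[OF fsl]] by (simp add: m_def)
      moreover have "H \<in> borel_measurable (array_space E)" unfolding H_def by measurable
      ultimately show ?thesis
        unfolding \<phi>_def using law[OF that] that good_pos(3)[OF that(1)] by simp
    qed
    have "\<forall>\<^sub>F n in both_inf. norm ((CLINT \<omega>|M. iexp (\<Sum>u\<in>D n. W n u \<omega>)) - \<phi> n ^ card (D n)) \<le>
        dep_coeff M (D n) (Y n) (a n) k t fs"
      using ev_good
    proof eventually_elim
      case (elim n)
      have fin: "finite (D n)" by (simp add: D grid_def)
      have "W n u \<in> borel_measurable M" if "u \<in> D n" for u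
        unfolding W_def block_vector_def using fY[OF fsl elim that] by simp
      from char_sum_factorization[OF fin this]
      show ?case
        by (simp only: dep_coeff_def sums W_def[symmetric] lex_after_def prod_constant W_law[OF elim] cong: prod.cong)
    qed
    then have "((\<lambda>n. (CLINT \<omega>|M. iexp (\<Sum>u\<in>D n. W n u \<omega>)) - \<phi> n ^ card (D n)) \<longlongrightarrow> 0) both_inf"
      using cond4[OF fs] by (rule Lim_null_comparison)
    from tendsto_add[OF this power]
    have "((\<lambda>n. CLINT \<omega>|M. iexp (\<Sum>u\<in>D n. W n u \<omega>)) \<longlongrightarrow> of_real (exp (- quad_form {1..k} C t / 2))) both_inf"
      by simp
    moreover have "of_real (exp (- quad_form {1..k} C t / 2)) = joint_char {1..k} (fidi N k (\<lambda>l x. x (fs l))) t"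
      unfolding C_def by (rule joint_char_fidi_gaussian[OF N(2) N_char fs, symmetric])
    moreover have "\<forall>\<^sub>F n in both_inf. (CLINT \<omega>|M. iexp (\<Sum>u\<in>D n. W n u \<omega>)) =
        joint_char {1..k} (fidi M k (\<lambda>l. empirical M (D n) (Y n) (a n) (fs l))) t"
      using ev_good by eventually_elim (rule emp[symmetric])
    ultimately show "((\<lambda>n. joint_char {1..k} (fidi M k (\<lambda>l. empirical M (D n) (Y n) (a n) (fs l))) t) \<longlongrightarrow>
        joint_char {1..k} (fidi N k (\<lambda>l x. x (fs l))) t) both_inf"
      by (simp only: Lim_transform_eventually)
  qed simp
  with N(3) show ?thesis by (intro exI[of _ N] exI[of _ "\<lambda>f x. x f"]) blast
qed

end
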